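(* Let $L$ and $L'$ be oriented links. If $\Phi^{(A^{(i)},B^{(i)})}_{X_2}(L)=\Phi^{(A^{(i)},B^{(i)})}_{X_2}(L')$ for some $i\in\{1,2,3,4,5\}$, then $\mathrm{LK}(L)=\mathrm{LK}(L')$.
   Context: Linking multiset: for an oriented link $L$ and (possibly empty) sublinks $L_1,L_2$ with $L=L_1\cup L_2$, $L_1\cap L_2=\emptyset$, $\mathrm{lk}(L_1,L_2)$ is the sum of the signs of those crossings of a diagram of $L$ at which the over-arc belongs to $L_1$ and the under-arc to $L_2$. $\mathrm{LK}(L)$ is the multiset $\{\mathrm{lk}(L_1,L_2)\mid L=L_1\cup L_2\}$ over all such ordered decompositions. Colorings: $X_2=\mathbb{Z}/2\mathbb{Z}$ with $[a,b,c]=a+b-c$. Let $D$ be a diagram of an oriented link; regions are the components of $\mathbb{R}^2\setminus D$. Rotate a crossing $c$ so that both strands point downward; let the left, top, bottom, right regions have colors $W,N,S,E$. Put $(x_c,y_c,z_c)=(W,N,S)$ if $c$ is positive and $(W,S,N)$ if $c$ is negative. A map $C$ from the regions to $X_2$ is an $X_2$-coloring if $E=[x_c,y_c,z_c]$ at every crossing; $\mathrm{cl}_C(c)=(x_c,y_c,z_c)$; $\mathrm{Col}_{X_2}(D)$ is the set of $X_2$-colorings. Universal brackets: $A^{(i)},B^{(i)}:X_2^3\to\mathbb{Z}[x_1^{\pm1},\dots,x_5^{\pm1}]$ (values written as subscripts). For every $i$: $A^{(i)}_{0,0,0}=A^{(i)}_{1,1,1}=x_1$, $A^{(i)}_{0,0,1}=x_2$,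 $A^{(i)}_{0,1,0}=x_3$, $A^{(i)}_{1,0,1}=x_4$, $A^{(i)}_{1,1,0}=x_2x_3x_4^{-1}$, $B^{(i)}_{0,0,0}=B^{(i)}_{1,1,1}=x_5$. For $i=1,3,5$: $A^{(i)}_{0,1,1}=A^{(i)}_{1,0,0}=x_1$, $B^{(i)}_{0,1,1}=B^{(i)}_{1,0,0}=x_5$. For $i=2,4$: $A^{(i)}_{0,1,1}=A^{(i)}_{1,0,0}=x_1^3x_5^{-2}$, $B^{(i)}_{0,1,1}=B^{(i)}_{1,0,0}=x_1^4x_5^{-3}$. For $i=1,2$: $B^{(i)}_{0,0,1}=x_1^{-1}x_2x_5$, $B^{(i)}_{0,1,0}=x_1x_3x_5^{-1}$, $B^{(i)}_{1,0,1}=x_1x_4x_5^{-1}$, $B^{(i)}_{1,1,0}=x_1^{-1}x_2x_3x_4^{-1}x_5$. For $i=3,4$: $B^{(i)}_{0,0,1}=x_1x_2x_5^{-1}$, $B^{(i)}_{0,1,0}=x_1^{-1}x_3x_5$, $B^{(i)}_{1,0,1}=x_1^{-1}x_4x_5$, $B^{(i)}_{1,1,0}=x_1x_2x_3x_4^{-1}x_5^{-1}$. For $i=5$: $B^{(5)}_{0,0,1}=x_1^{-1}x_2x_5$, $B^{(5)}_{0,1,0}=x_1^{-1}x_3x_5$, $B^{(5)}_{1,0,1}=x_1^{-1}x_4x_5$, $B^{(5)}_{1,1,0}=x_1^{-1}x_2x_3x_4^{-1}x_5$. Put $\delta=-x_1x_5^{-1}-x_1^{-1}x_5$ and $w=-x_1^2x_5^{-1}$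 (the same for all $i$). Polynomial: a state is a map $s$ from crossings of $D$ to $\{A^{(i)},B^{(i)}\}$; $k_s$ is the number of circles after replacing each crossing with $s(c)=A^{(i)}$ by its orientation-respecting smoothing and each crossing with $s(c)=B^{(i)}$ by the other smoothing. With $p,n$ the numbers of positive and negative crossings, $\beta^{(A^{(i)},B^{(i)})}_{X_2}(D,C)=w^{n-p}\sum_s\delta^{k_s}\prod_c s(c)(\mathrm{cl}_C(c))^{\mathrm{sign}(c)}$, and $\Phi^{(A^{(i)},B^{(i)})}_{X_2}(L)=\sum_{C\in\mathrm{Col}_{X_2}(D)}u^{\beta^{(A^{(i)},B^{(i)})}_{X_2}(D,C)}$, a formal sum (equivalently, the multiset of values $\beta$), which is independent of the diagram $D$ of $L$. *)

theory Defs
  imports "HOL-Analysis.Analysis" "HOL-Library.Multiset" "HOL-Library.Poly_Mapping"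
    "HOL-Library.Z2"
begin

section \<open>Oriented polygonal links\<close>

text \<open>
  Three-space is \<open>complex \<times> real\<close>: the first component is the plane of projection and the second
  one is the height. A tame oriented link is given by a polygonal representative: a finite set of
  vertices together with the permutation that sends every vertex to the next one along the
  orientation. The link components are the cycles of this permutation.
\<close>

type_synonym point = "complex \<times> real"

record link =
  verts :: "point set"
  nxt :: "point \<Rightarrow> point"

definition edge :: "link \<Rightarrow> point \<Rightarrow> point set" where
  "edge L v = closed_segment v (nxt L v)"

definition support :: "link \<Rightarrow> point set" where
  "support L = (\<Union>v\<in>verts L. edge L v)"

text \<open>
  Disjointness of the half-open edges says that the closed polygons are simple and pairwise
  disjoint. The empty link is allowed.
\<close>

definition oriented_link :: "link \<Rightarrow> bool" where
  "oriented_link L \<longleftrightarrow>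
     finite (verts L) \<and> nxt L permutes verts L \<and>
     (\<forall>v\<in>verts L. nxt L v \<noteq> v) \<and>
     (\<forall>v\<in>verts L. \<forall>v'\<in>verts L. v \<noteq> v' \<longrightarrow>
        (edge L v - {nxt L v}) \<inter> (edge L v' - {nxt L v'}) = {})"

text \<open>
  Reidemeister's elementary move replaces an edge of the link by the other two sides of a triangle
  that meets the link only in that edge (the new vertex may also subdivide the edge). These moves
  and their inverses generate isotopy of oriented polygonal links.
\<close>

definition triangle_move :: "link \<Rightarrow> link \<Rightarrow> bool" where
  "triangle_move L L' \<longleftrightarrow>
     oriented_link L \<and> oriented_link L' \<and>
     (\<exists>v\<in>verts L. \<exists>w. w \<notin> verts L \<and>
        convex hull {v, w, nxt L v} \<inter> support L = edge L v \<and>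
        verts L' = insert w (verts L) \<and>
        nxt L' = (nxt L)(v := w, w := nxt L v))"

definition link_isotopic :: "link \<Rightarrow> link \<Rightarrow> bool" where
  "link_isotopic = equivclp triangle_move"


section \<open>Diagrams\<close>

text \<open>
  A diagram is a link in regular position: the projection to the plane identifies at most two
  points of the link at a time, and never identifies a vertex with another point.
  In particular no edge is vertical, and projected edges meet transversally at crossings.
  The heights are only used to tell the over-arc from the under-arc at a crossing.
\<close>

definition regular_position :: "link \<Rightarrow> bool" where
  "regular_position D \<longleftrightarrow>
     (\<forall>v\<in>verts D. \<forall>x\<in>support D. fst x = fst v \<longrightarrow> x = v) \<and>
     (\<forall>z. finite {x\<in>support D. fst x = z} \<and> card {x\<in>support D. fst x = z} \<le> 2)"

definition diagram_of :: "link \<Rightarrow> link \<Rightarrow> bool" where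
  "diagram_of L D \<longleftrightarrow> oriented_link D \<and> regular_position D \<and> link_isotopic L D"

definition plane_curve :: "link \<Rightarrow> complex set" where
  "plane_curve D = fst ` support D"

text \<open>
  A crossing is the pair of its over-edge and its under-edge, each named by its initial vertex; two
  straight edges cross at most once, so the pair determines the crossing.
\<close>

type_synonym crossing = "point \<times> point"

definition crossings :: "link \<Rightarrow> crossing set" where
  "crossings D = {(a, b). a \<in> verts D \<and> b \<in> verts D \<and>
     (\<exists>x\<in>edge D a. \<exists>y\<in>edge D b. fst x = fst y \<and> snd x > snd y)}"

definition crossing_point :: "link \<Rightarrow> crossing \<Rightarrow> complex" where
  "crossing_point D c = (THE z. z \<in> fst ` edge D (fst c) \<inter> fst ` edge D (snd c))"

definition direction :: "link \<Rightarrow> point \<Rightarrow> complex" where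
  "direction D v = fst (nxt D v) - fst v"

definition over_dir :: "link \<Rightarrow> crossing \<Rightarrow> complex" where
  "over_dir D c = direction D (fst c)"

definition under_dir :: "link \<Rightarrow> crossing \<Rightarrow> complex" where
  "under_dir D c = direction D (snd c)"

text \<open>
  \<open>Im (cnj o * u)\<close> is the determinant of the pair \<open>(o, u)\<close>: a crossing is positive if the
  over-direction is turned counterclockwise to reach the under-direction.
\<close>

definition crossing_sign :: "link \<Rightarrow> crossing \<Rightarrow> int" where
  "crossing_sign D c = (if Im (cnj (over_dir D c) * under_dir D c) > 0 then 1 else - 1)"


section \<open>Linking multiset\<close>

definition sublink :: "link \<Rightarrow> point set \<Rightarrow> bool" where
  "sublink D S \<longleftrightarrow> S \<subseteq> verts D \<and> nxt D ` S = S"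

definition lk :: "link \<Rightarrow> point set \<Rightarrow> point set \<Rightarrow> int" where
  "lk D S\<^sub>1 S\<^sub>2 = (\<Sum>c\<in>{c \<in> crossings D. fst c \<in> S\<^sub>1 \<and> snd c \<in> S\<^sub>2}. crossing_sign D c)"

definition decompositions :: "link \<Rightarrow> (point set \<times> point set) set" where
  "decompositions D = {(S\<^sub>1, S\<^sub>2). sublink D S\<^sub>1 \<and> sublink D S\<^sub>2 \<and>
     S\<^sub>1 \<union> S\<^sub>2 = verts D \<and> S\<^sub>1 \<inter> S\<^sub>2 = {}}"

definition LK :: "link \<Rightarrow> int multiset" where
  "LK D = image_mset (\<lambda>(S\<^sub>1, S\<^sub>2). lk D S\<^sub>1 S\<^sub>2) (mset_set (decompositions D))"


section \<open>Colorings\<close>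

definition regions :: "link \<Rightarrow> complex set set" where
  "regions D = components (- plane_curve D)"

text \<open>The member of a family of disjoint sets entered when leaving \<open>z\<close> in direction \<open>d\<close>.\<close>

definition entered :: "complex set set \<Rightarrow> complex \<Rightarrow> complex \<Rightarrow> complex set" where
  "entered F z d = (THE R. R \<in> F \<and> (\<forall>\<^sub>F t in at_right 0. z + of_real t * d \<in> R))"

definition corner :: "link \<Rightarrow> crossing \<Rightarrow> complex \<Rightarrow> complex set" where
  "corner D c d = entered (regions D) (crossing_point D c) d"

text \<open>
  With both strands pointing downward, the top corner lies behind both strands and the bottom
  corner ahead of both. The strand running from top right to bottom left is the over-strand at a
  positive crossing and the under-strand at a negative one; the left corner lies ahead of
  it and behind the other strand.
\<close>

definition top_region :: "link \<Rightarrow> crossing \<Rightarrow> complex set" where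
  "top_region D c = corner D c (- over_dir D c - under_dir D c)"

definition bottom_region :: "link \<Rightarrow> crossing \<Rightarrow> complex set" where
  "bottom_region D c = corner D c (over_dir D c + under_dir D c)"

definition left_region :: "link \<Rightarrow> crossing \<Rightarrow> complex set" where
  "left_region D c = corner D c
     (if crossing_sign D c = 1 then over_dir D c - under_dir D c
      else under_dir D c - over_dir D c)"

definition right_region :: "link \<Rightarrow> crossing \<Rightarrow> complex set" where
  "right_region D c = corner D c
     (if crossing_sign D c = 1 then under_dir D c - over_dir D c
      else over_dir D c - under_dir D c)"

definition ternary :: "bit \<Rightarrow> bit \<Rightarrow> bit \<Rightarrow> bit" where
  "ternary a b c = a + b - c"

definition color_triple :: "link \<Rightarrow> (complex set \<Rightarrow> bit) \<Rightarrow> crossing \<Rightarrow> bit \<times> bit \<times> bit" where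
  "color_triple D C c =
     (if crossing_sign D c = 1
      then (C (left_region D c), C (top_region D c), C (bottom_region D c))
      else (C (left_region D c), C (bottom_region D c), C (top_region D c)))"

definition Col :: "link \<Rightarrow> (complex set \<Rightarrow> bit) set" where
  "Col D = {C \<in> regions D \<rightarrow>\<^sub>E UNIV. \<forall>c\<in>crossings D.
     C (right_region D c) = (case color_triple D C c of (x, y, z) \<Rightarrow> ternary x y z)}"


section \<open>The brackets\<close>

text \<open>Laurent polynomials in five variables over the integers: the group ring of \<open>int ^ 5\<close>.\<close>

type_synonym laurent = "(int ^ 5) \<Rightarrow>\<^sub>0 int"

text \<open>\<open>X j k\<close> is the \<open>k\<close>-th power of the \<open>j\<close>-th variable, \<open>k\<close> being any integer.\<close>

definition X :: "5 \<Rightarrow> int \<Rightarrow> laurent" where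
  "X j k = Poly_Mapping.single (axis j k) 1"

text \<open>Integer powers; negative exponents are meant for invertible bases only.\<close>

definition zpow :: "'a :: comm_ring_1 \<Rightarrow> int \<Rightarrow> 'a" where
  "zpow a k = (if 0 \<le> k then a ^ nat k else (THE b. a * b = 1) ^ nat (- k))"

datatype marker = MarkA | MarkB

definition bracket_A :: "nat \<Rightarrow> bit \<times> bit \<times> bit \<Rightarrow> laurent" where
  "bracket_A i t =
     (if t = (0, 0, 0) \<or> t = (1, 1, 1) then X 1 1
      else if t = (0, 0, 1) then X 2 1
      else if t = (0, 1, 0) then X 3 1
      else if t = (1, 0, 1) then X 4 1
      else if t = (1, 1, 0) then X 2 1 * X 3 1 * X 4 (- 1)
      else \<comment> \<open>\<open>t = (0, 1, 1)\<close> or \<open>t = (1, 0, 0)\<close>\<close>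
        if i \<in> {1, 3, 5} then X 1 1 else X 1 3 * X 5 (- 2))"

definition bracket_B :: "nat \<Rightarrow> bit \<times> bit \<times> bit \<Rightarrow> laurent" where
  "bracket_B i t =
     (if t = (0, 0, 0) \<or> t = (1, 1, 1) then X 5 1
      else if t = (0, 0, 1) then
        (if i \<in> {1, 2, 5} then X 1 (- 1) * X 2 1 * X 5 1 else X 1 1 * X 2 1 * X 5 (- 1))
      else if t = (0, 1, 0) then
        (if i \<in> {1, 2} then X 1 1 * X 3 1 * X 5 (- 1) else X 1 (- 1) * X 3 1 * X 5 1)
      else if t = (1, 0, 1) then
        (if i \<in> {1, 2} then X 1 1 * X 4 1 * X 5 (- 1) else X 1 (- 1) * X 4 1 * X 5 1)
      else if t = (1, 1, 0) then
        (if i \<in> {1, 2, 5} then X 1 (- 1) * X 2 1 * X 3 1 * X 4 (- 1) * X 5 1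
         else X 1 1 * X 2 1 * X 3 1 * X 4 (- 1) * X 5 (- 1))
      else \<comment> \<open>\<open>t = (0, 1, 1)\<close> or \<open>t = (1, 0, 0)\<close>\<close>
        if i \<in> {1, 3, 5} then X 5 1 else X 1 4 * X 5 (- 3))"

definition bracket :: "nat \<Rightarrow> marker \<Rightarrow> bit \<times> bit \<times> bit \<Rightarrow> laurent" where
  "bracket i m = (case m of MarkA \<Rightarrow> bracket_A i | MarkB \<Rightarrow> bracket_B i)"

definition delta :: laurent where
  "delta = - X 1 1 * X 5 (- 1) - X 1 (- 1) * X 5 1"

definition w_unit :: laurent where
  "w_unit = - X 1 2 * X 5 (- 1)"


section \<open>States and the invariant\<close>

definition states :: "link \<Rightarrow> (crossing \<Rightarrow> marker) set" where
  "states D = crossings D \<rightarrow>\<^sub>E UNIV"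

text \<open>
  Cutting the diagram at its crossings leaves open arcs, and a closed curve for every component
  without crossings. A state glues the ends of the arcs in pairs at every crossing; the resulting
  circles are the classes of the equivalence relation generated by the gluing.
\<close>

definition arcs :: "link \<Rightarrow> complex set set" where
  "arcs D = components (plane_curve D - crossing_point D ` crossings D)"

definition arc_at :: "link \<Rightarrow> crossing \<Rightarrow> complex \<Rightarrow> complex set" where
  "arc_at D c d = entered (arcs D) (crossing_point D c) d"

definition glued_at :: "link \<Rightarrow> marker \<Rightarrow> crossing \<Rightarrow> (complex set \<times> complex set) set" where
  "glued_at D m c =
     (let over_in = arc_at D c (- over_dir D c); over_out = arc_at D c (over_dir D c);
          under_in = arc_at D c (- under_dir D c); under_out = arc_at D c (under_dir D c)
      in case m of
           MarkA \<Rightarrow> {(over_in, under_out), (under_in, over_out)}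
         | MarkB \<Rightarrow> {(over_in, under_in), (over_out, under_out)})"

definition circles :: "link \<Rightarrow> (crossing \<Rightarrow> marker) \<Rightarrow> nat" where
  "circles D s =
     (let G = (\<Union>c\<in>crossings D. glued_at D (s c) c) in card (arcs D // (G \<union> G\<inverse>)\<^sup>*))"

definition pos_crossings :: "link \<Rightarrow> nat" where
  "pos_crossings D = card {c \<in> crossings D. crossing_sign D c = 1}"

definition neg_crossings :: "link \<Rightarrow> nat" where
  "neg_crossings D = card {c \<in> crossings D. crossing_sign D c = - 1}"

definition beta :: "nat \<Rightarrow> link \<Rightarrow> (complex set \<Rightarrow> bit) \<Rightarrow> laurent" where
  "beta i D C =
     zpow w_unit (int (neg_crossings D) - int (pos_crossings D)) *
     (\<Sum>s\<in>states D. delta ^ circles D s *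
        (\<Prod>c\<in>crossings D. zpow (bracket i (s c) (color_triple D C c)) (crossing_sign D c)))"

definition Phi :: "nat \<Rightarrow> link \<Rightarrow> laurent multiset" where
  "Phi i D = image_mset (beta i D) (mset_set (Col D))"

end

(*
  Evaluate the Laurent polynomials at x_1 = x_3 = x_4 = 1, x_2 = 2 and x_5 = exp(2 pi i / 3).
  Then delta = 1, so the number of circles of a state plays no role and the state sum factors into
  the sums A^e + B^e over the crossings c, where e = sign(c). Each of them has absolute value 2^e
  if the triple at c is (0,0,1) or (1,1,0), and 1 otherwise; these two triples say that the two
  sides of the over-strand, but not those of the under-strand, have different colors. Let S be the
  set of edges whose two sides have different colors: this is a sublink, and by the above the
  absolute value of the evaluated bracket is 2^lk(S, L - S). Every sublink S arises from exactly
  two colorings, which differ by a constant, so Phi determines 2 LK and hence LK.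

  A coloring inducing S is the parity of the winding number of S, and two colorings inducing the
  same S have a locally constant difference on the complement of a finite set of points.
*)
theory Submission imports Defs begin

section \<open>A specialization of the brackets\<close>

text \<open>At every triple, each of the five brackets has B / A equal to x_5 / x_1 or its inverse.
  Taking a primitive cube root of unity for x_5 / x_1 therefore gives \<open>delta = 1\<close> and
  |1 + (B / A)^e| = 1 for e = 1 and e = -1, for all five brackets at once. What remains is |A|, and
  x_2 occurs in A only at (0,0,1) and (1,1,0). The absolute value also discards the phases, among
  them the writhe factor.

  The obstacle is planar topology: regions are bare connected components without any combinatorial
  structure. A region is therefore seen only near a point, inside a convex cone of directions
  (\<open>germ\<close>), and the point is moved along the edges. The color difference across an edge
  propagates in this way, through vertices by geometry and through crossings by the coloring rule.
  Conversely, colorings come from winding numbers written as sums of principal logarithms, where the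
  branch cut supplies the change across an edge.\<close>

definition laurent_eval :: "(5 \<Rightarrow> complex) \<Rightarrow> laurent \<Rightarrow> complex" where
  "laurent_eval y p =
     (\<Sum>k\<in>Poly_Mapping.keys p. of_int (Poly_Mapping.lookup p k) * (\<Prod>j\<in>UNIV. y j powi (k $ j)))"

lemma laurent_eval_superset:
  assumes "finite A" "Poly_Mapping.keys p \<subseteq> A"
  shows "laurent_eval y p =
    (\<Sum>k\<in>A. of_int (Poly_Mapping.lookup p k) * (\<Prod>j\<in>UNIV. y j powi (k $ j)))"
  unfolding laurent_eval_def
  by (intro sum.mono_neutral_left assms) (auto simp: in_keys_iff)

lemma laurent_eval_0 [simp]: "laurent_eval y 0 = 0"
  by (simp add: laurent_eval_def)

lemma laurent_eval_single:
  "laurent_eval y (Poly_Mapping.single k a) = of_int a * (\<Prod>j\<in>UNIV. y j powi (k $ j))"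
  by (subst laurent_eval_superset[where A = "{k}"]) (auto simp: lookup_single)

lemma laurent_eval_1 [simp]: "laurent_eval y 1 = 1"
  by (simp flip: single_one add: laurent_eval_single)

lemma laurent_eval_add: "laurent_eval y (p + q) = laurent_eval y p + laurent_eval y q"
proof -
  let ?A = "Poly_Mapping.keys p \<union> Poly_Mapping.keys q"
  have "Poly_Mapping.keys (p + q) \<subseteq> ?A"
    by (rule Poly_Mapping.keys_add)
  then show ?thesis
    by (subst (1 2 3) laurent_eval_superset[where A = ?A])
      (auto simp: lookup_add sum.distrib distrib_right)
qed

lemma laurent_eval_uminus: "laurent_eval y (- p) = - laurent_eval y p"
  using laurent_eval_add[of y p "- p"] by (simp add: eq_neg_iff_add_eq_0 add.commute)

lemma laurent_eval_diff: "laurent_eval y (p - q) = laurent_eval y p - laurent_eval y q"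
  using laurent_eval_add[of y p "- q"] by (simp add: laurent_eval_uminus)

text \<open>Updating a fresh key amounts to adding a monomial, so additive statements reduce to
  monomials.\<close>

lemma poly_mapping_add_induct [case_names zero single add]:
  fixes p :: "'a \<Rightarrow>\<^sub>0 'b::monoid_add"
  assumes "P 0" "\<And>k a. P (Poly_Mapping.single k a)" "\<And>p q. P p \<Longrightarrow> P q \<Longrightarrow> P (p + q)"
  shows "P p"
proof (induction p rule: update_induct)
  case const
  show ?case by fact
next
  case (update f a b)
  have "Poly_Mapping.update a b f = f + Poly_Mapping.single a b"
    using update(1)
    by (intro poly_mapping_eqI) (auto simp: lookup_update lookup_add lookup_single in_keys_iff)
  then show ?case
    using assms update by simp
qed

text \<open>Both sides are biadditive, so monomials suffice; there it is the law of exponents, which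
  for \<open>powi\<close> wants nonzero bases.\<close>

lemma laurent_eval_mult:
  assumes y: "\<And>j. y j \<noteq> 0"
  shows "laurent_eval y (p * q) = laurent_eval y p * laurent_eval y q"
proof (induction p rule: poly_mapping_add_induct)
  case (single k a)
  show ?case
  proof (induction q rule: poly_mapping_add_induct)
    case (single l b)
    have "(\<Prod>j\<in>UNIV. y j powi ((k + l) $ j)) =
      (\<Prod>j\<in>UNIV. y j powi (k $ j)) * (\<Prod>j\<in>UNIV. y j powi (l $ j))"
      by (simp add: prod.distrib[symmetric] power_int_add y)
    then show ?case
      by (simp add: Poly_Mapping.mult_single laurent_eval_single mult_ac)
  qed (simp_all add: laurent_eval_add distrib_left)
qed (simp_all add: laurent_eval_add distrib_right)

lemma laurent_eval_power:
  "(\<And>j. y j \<noteq> 0) \<Longrightarrow> laurent_eval y (p ^ n) = laurent_eval y p ^ n"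
  by (induction n) (simp_all add: laurent_eval_mult)

lemma laurent_eval_sum: "laurent_eval y (\<Sum>x\<in>A. f x) = (\<Sum>x\<in>A. laurent_eval y (f x))"
  by (induction A rule: infinite_finite_induct) (simp_all add: laurent_eval_add)

lemma laurent_eval_prod:
  "(\<And>j. y j \<noteq> 0) \<Longrightarrow> laurent_eval y (\<Prod>x\<in>A. f x) = (\<Prod>x\<in>A. laurent_eval y (f x))"
  by (induction A rule: infinite_finite_induct) (simp_all add: laurent_eval_mult)

lemma laurent_eval_X: "laurent_eval y (X j k) = y j powi k"
proof -
  have "(\<Prod>i\<in>UNIV. y i powi (axis j k $ i)) = (\<Prod>i\<in>UNIV. if i = j then y j powi k else 1)"
    by (intro prod.cong) (auto simp: axis_def)
  then show ?thesis
    by (simp add: X_def laurent_eval_single)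
qed

text \<open>Inverses in a commutative ring are unique, so the description in \<open>zpow\<close>
  denotes the inverse of the unit \<open>a\<close>, and evaluation preserves it.\<close>

lemma zpow_eval:
  assumes y: "\<And>j. y j \<noteq> 0" and a: "a dvd 1"
  shows "laurent_eval y (zpow a k) = laurent_eval y a powi k"
proof (cases "0 \<le> k")
  case True
  then show ?thesis
    by (simp add: zpow_def laurent_eval_power y power_int_def)
next
  case False
  from a obtain b where b: "a * b = 1"
    by (metis dvd_def)
  have "b' = b" if "a * b' = 1" for b'
  proof -
    have "b' = (a * b) * b'" by (simp add: b)
    also have "\<dots> = b * (a * b')" by (simp only: mult_ac)
    finally show ?thesis by (simp add: that)
  qed
  then have "(THE b. a * b = 1) = b"
    using b by blast
  moreover have "laurent_eval y a * laurent_eval y b = 1"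
    by (metis b laurent_eval_1 laurent_eval_mult y)
  then have "laurent_eval y b = inverse (laurent_eval y a)"
    by (metis inverse_unique)
  ultimately show ?thesis
    using False by (simp add: zpow_def laurent_eval_power y power_int_def)
qed

lemma X_mult_minus: "X j k * X j (- k) = 1"
proof -
  have "axis j k + axis j (- k) = (0 :: int ^ 5)"
    by (simp add: vec_eq_iff axis_def)
  then show ?thesis
    by (simp add: X_def Poly_Mapping.mult_single)
qed

lemma X_dvd_1: "X j k dvd 1"
  by (metis X_mult_minus dvd_triv_left)

lemma bracket_dvd_1: "bracket i m t dvd 1"
proof -
  have mult: "a * b dvd 1" if "a dvd 1" "b dvd 1" for a b :: laurent
    using mult_dvd_mono[OF that] by simp
  show ?thesis
    by (cases m) (auto simp: bracket_def bracket_A_def bracket_B_def intro!: mult X_dvd_1)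
qed

section \<open>The point of evaluation\<close>

definition omega :: complex where
  "omega = cis (2 * pi / 3)"

lemma omega_eq: "omega = Complex (- 1 / 2) (sqrt 3 / 2)"
  by (simp add: omega_def complex_eq_iff cos_120 sin_120)

lemma omega_facts: "omega \<noteq> 0" "omega * omega = - 1 - omega" "inverse omega = - 1 - omega"
  "norm omega = 1" "norm (1 + omega) = 1"
proof -
  show "omega \<noteq> 0" "norm omega = 1"
    by (simp_all add: omega_def)
  show sq: "omega * omega = - 1 - omega"
    by (simp add: omega_eq complex_eq_iff)
  show "inverse omega = - 1 - omega"
    using sq by (intro inverse_unique) (simp only: right_diff_distrib, simp)
  show "norm (1 + omega) = 1"
    by (simp add: omega_eq cmod_def power2_eq_square)
qed

text \<open>In the type \<open>5\<close> the numeral 5 equals 0, so 1 to 5 name its five elements.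
  The value 2 is chosen because its integer powers are distinct, so that exponents can be read
  off.\<close>

definition eval_point :: "5 \<Rightarrow> complex" where
  "eval_point j = (if j = 5 then omega else if j = 2 then 2 else 1)"

lemma eval_point_simps: "eval_point 1 = 1" "eval_point 2 = 2" "eval_point 3 = 1"
  "eval_point 4 = 1" "eval_point 5 = omega" "eval_point j \<noteq> 0"
  by (auto simp: eval_point_def omega_facts)


text \<open>The cube roots of unity sum to 0, so \<open>1 + omega powi e\<close> is minus the third
  root and has norm 1. The disjunction reflects that B / A may be \<open>omega\<close> or its
  inverse.\<close>

lemma norm_powi_add_powi:
  assumes "b = omega * a \<or> a = omega * b" "norm a = r" "e = 1 \<or> e = -1"
  shows "norm (a powi e + b powi e) = r powi e"
proof -
  have main: "norm (a powi e + (omega * a) powi e) = norm a powi e" for a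
  proof -
    have "1 + inverse omega = - omega"
      by (simp add: omega_facts)
    then have "norm (1 + omega powi e) = 1"
      using assms(3) omega_facts by auto
    moreover have "a powi e + (omega * a) powi e = a powi e * (1 + omega powi e)"
      by (simp add: power_int_mult_distrib algebra_simps)
    ultimately show ?thesis
      by (simp add: norm_mult norm_power_int)
  qed
  have "norm b = norm a"
    using assms(1) by (auto simp: norm_mult omega_facts)
  with main[of a] main[of b] assms show ?thesis
    by (auto simp: add.commute)
qed

lemma omega_powi: "omega powi 2 = - 1 - omega" "omega powi (- 1) = - 1 - omega"
  "omega powi (- 2) = omega" "omega powi 3 = 1" "omega powi (- 3) = 1"
proof -
  have 3: "omega powi 3 = 1"
    by (simp add: power3_eq_cube omega_facts algebra_simps)
  show "omega powi 2 = - 1 - omega" "omega powi (- 1) = - 1 - omega"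
    by (simp_all add: power2_eq_square omega_facts power_int_minus)
  show "omega powi 3 = 1" by (rule 3)
  show "omega powi (- 3) = 1" using 3 by (simp only: power_int_minus) simp
  have "omega powi (- 2) = omega powi 1 * omega powi (- 3)"
    by (subst power_int_add[symmetric]) (simp_all add: omega_facts)
  then show "omega powi (- 2) = omega"
    using \<open>omega powi (- 3) = 1\<close> by simp
qed

lemma bracket_ratio:
  fixes t :: "bit \<times> bit \<times> bit"
  assumes "i \<in> {1, 2, 3, 4, 5}"
  defines "a \<equiv> laurent_eval eval_point (bracket i MarkA t)"
    and "b \<equiv> laurent_eval eval_point (bracket i MarkB t)"
  shows "(b = omega * a \<or> a = omega * b) \<and>
    norm a = (if t \<in> {(0, 0, 1), (1, 1, 0)} then 2 else 1)"
proof -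
  obtain x y z where t: "t = (x, y, z)"
    by (cases t)
  have w: "omega * (- 1 - omega) = 1"
    by (simp add: algebra_simps omega_facts)
  have w2: "omega * (omega * 2) = - 2 - 2 * omega"
    by (simp add: mult.assoc[symmetric] omega_facts)
  show ?thesis
    using assms(1) w
    by (cases x; cases y; cases z)
      (auto simp: a_def b_def t bracket_def bracket_A_def bracket_B_def laurent_eval_mult
        laurent_eval_X eval_point_simps omega_powi omega_facts w2 algebra_simps)
qed

lemma power_int_sum:
  fixes x :: "'a::field"
  assumes "x \<noteq> 0"
  shows "x powi (\<Sum>i\<in>A. f i) = (\<Prod>i\<in>A. x powi f i)"
  using assms by (induction A rule: infinite_finite_induct) (auto simp: power_int_add)

lemma norm_eval_beta:
  assumes fin: "finite (crossings D)" and i: "i \<in> {1, 2, 3, 4, 5}"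
  shows "norm (laurent_eval eval_point (beta i D C)) =
    2 powi (\<Sum>c\<in>{c\<in>crossings D. color_triple D C c \<in> {(0, 0, 1), (1, 1, 0)}}. crossing_sign D c)"
proof -
  let ?E = "laurent_eval eval_point"
  let ?s = "crossing_sign D" and ?t = "color_triple D C"
  have nz: "eval_point j \<noteq> 0" for j
    by (simp add: eval_point_simps)
  have w: "norm (?E (zpow w_unit k)) = 1" for k
  proof -
    \<comment> \<open>The explicit inverse makes \<open>w_unit\<close> a unit, as
      \<open>zpow_eval\<close> demands.\<close>
    have "w_unit * - (X 1 (- 2) * X 5 1) = (X 1 2 * X 1 (- 2)) * (X 5 (- 1) * X 5 1)"
      by (simp add: w_unit_def mult_ac)
    also have "\<dots> = 1"
      using X_mult_minus[of 1 2] X_mult_minus[of 5 "- 1"] by simp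
    finally have "w_unit dvd 1"
      by (metis dvd_triv_left)
    moreover have "norm (?E w_unit) = 1"
      by (simp add: w_unit_def laurent_eval_uminus laurent_eval_mult nz laurent_eval_X
          eval_point_simps norm_mult norm_power_int norm_inverse omega_facts(4) power_int_minus)
    ultimately show ?thesis
      by (simp add: zpow_eval nz norm_power_int)
  qed
  have d: "?E delta = 1"
    by (simp add: delta_def laurent_eval_diff laurent_eval_uminus laurent_eval_mult nz
        laurent_eval_X eval_point_simps omega_powi omega_facts(3))
  have sum: "?E (\<Sum>s\<in>states D. delta ^ circles D s *
        (\<Prod>c\<in>crossings D. zpow (bracket i (s c) (?t c)) (?s c))) =
      (\<Sum>s\<in>states D. \<Prod>c\<in>crossings D. ?E (bracket i (s c) (?t c)) powi ?s c)"
    by (simp add: laurent_eval_sum laurent_eval_mult nz laurent_eval_power d laurent_eval_prod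
        zpow_eval bracket_dvd_1)
  \<comment> \<open>Distributivity: a state is an independent choice of a marker at every
    crossing.\<close>
  also have "\<dots> = (\<Prod>c\<in>crossings D. \<Sum>m\<in>UNIV. ?E (bracket i m (?t c)) powi ?s c)"
    unfolding states_def
    by (rule prod_sum_PiE[symmetric]) (use fin in \<open>auto intro: finite_subset[of _ "{MarkA, MarkB}"] marker.exhaust\<close>)
  finally have "norm (?E (beta i D C)) =
      (\<Prod>c\<in>crossings D. norm (\<Sum>m\<in>UNIV. ?E (bracket i m (?t c)) powi ?s c))"
    by (simp add: beta_def laurent_eval_mult nz norm_mult w prod_norm)
  also have "\<dots> = (\<Prod>c\<in>crossings D.
      2 powi (if ?t c \<in> {(0, 0, 1), (1, 1, 0)} then ?s c else 0))"
  proof (rule prod.cong[OF refl])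
    fix c
    have UN: "UNIV = {MarkA, MarkB}"
      using marker.exhaust by blast
    have s: "?s c = 1 \<or> ?s c = - 1"
      by (auto simp: crossing_sign_def)
    note r = bracket_ratio[OF i, of "?t c"]
    have "norm (\<Sum>m\<in>UNIV. ?E (bracket i m (?t c)) powi ?s c) =
        (if ?t c \<in> {(0, 0, 1), (1, 1, 0)} then 2 else 1) powi ?s c"
      using norm_powi_add_powi[OF conjunct1[OF r] conjunct2[OF r] s] by (simp add: UN)
    then show "norm (\<Sum>m\<in>UNIV. ?E (bracket i m (?t c)) powi ?s c) =
        2 powi (if ?t c \<in> {(0, 0, 1), (1, 1, 0)} then ?s c else 0)"
      by simp
  qed
  also have "\<dots> = 2 powi (\<Sum>c\<in>crossings D. if ?t c \<in> {(0, 0, 1), (1, 1, 0)} then ?s c else 0)"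
    by (rule power_int_sum[symmetric]) simp
  finally show ?thesis
    using fin by (simp add: sum.inter_filter)
qed

section \<open>Regions near a point of the diagram\<close>

definition wedge :: "complex \<Rightarrow> complex \<Rightarrow> real" where
  "wedge p q = Im (cnj p * q)"

lemma wedge_simps [simp]:
  "wedge p p = 0" "wedge 0 q = 0" "wedge p 0 = 0"
  "wedge (- p) q = - wedge p q" "wedge p (- q) = - wedge p q"
  "wedge (of_real k * p) q = k * wedge p q" "wedge p (of_real k * q) = k * wedge p q"
  "wedge (p + q) r = wedge p r + wedge q r" "wedge p (q + r) = wedge p q + wedge p r"
  "wedge (p - q) r = wedge p r - wedge q r" "wedge p (q - r) = wedge p q - wedge p r"
  by (simp_all add: wedge_def algebra_simps)

lemma wedge_commute: "wedge q p = - wedge p q"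
  by (simp add: wedge_def algebra_simps)

lemma wedge_eq_0:
  assumes "wedge p q = 0" "p \<noteq> 0"
  obtains k where "q = of_real k * p"
proof
  have "cnj p * q = of_real (Re (cnj p * q))"
    using assms(1) by (simp add: complex_eq_iff wedge_def)
  then have "p * cnj p * q = of_real (Re (cnj p * q)) * p"
    by (metis mult.assoc mult.commute)
  moreover have "p * cnj p = of_real ((norm p)\<^sup>2)"
    by (rule complex_norm_square[symmetric])
  ultimately show "q = of_real (Re (cnj p * q) / (norm p)\<^sup>2) * p"
    using assms(2) by (simp add: field_simps)
qed

definition left_of :: "complex \<Rightarrow> complex set" where
  "left_of d = {x. wedge d x > 0}"

text \<open>Convexity makes a truncated cone connected, so that it can stay in one region; omitting
  the apex allows the apex to lie on the diagram. Half planes and sectors are the instances in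
  use.\<close>

definition blunt_cone :: "complex set \<Rightarrow> bool" where
  "blunt_cone K \<longleftrightarrow> convex K \<and> 0 \<notin> K \<and> K \<noteq> {} \<and> (\<forall>t>0. \<forall>x\<in>K. of_real t * x \<in> K)"

lemma mem_left_of: "x \<in> left_of d \<longleftrightarrow> wedge d x > 0"
  by (simp add: left_of_def)

lemma open_left_of: "open (left_of d)"
  unfolding left_of_def wedge_def by (intro open_Collect_less continuous_intros)

lemma convex_left_of: "convex (left_of d)"
proof -
  have "left_of d = {x. inner (\<i> * d) x > 0}"
    by (auto simp: left_of_def wedge_def inner_complex_def algebra_simps)
  then show ?thesis
    by (simp add: convex_halfspace_gt)
qed

lemma left_of_scale:
  "t > 0 \<Longrightarrow> of_real t * x \<in> left_of d \<longleftrightarrow> x \<in> left_of d"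
  by (simp add: mem_left_of zero_less_mult_iff)

lemma left_of_rotated: "d \<noteq> 0 \<Longrightarrow> \<i> * d \<in> left_of d"
  by (auto simp: mem_left_of wedge_def complex_eq_iff power2_eq_square[symmetric] sum_power2_gt_zero_iff)

lemma blunt_cone_left_of: "d \<noteq> 0 \<Longrightarrow> blunt_cone (left_of d)"
  unfolding blunt_cone_def
  using convex_left_of left_of_scale left_of_rotated[of d] by (auto simp: mem_left_of[of 0])

lemma blunt_cone_Int:
  assumes "blunt_cone K" "blunt_cone K'" "K \<inter> K' \<noteq> {}"
  shows "blunt_cone (K \<inter> K')"
  using assms by (auto simp: blunt_cone_def convex_Int)

definition pedge :: "link \<Rightarrow> point \<Rightarrow> complex set" where
  "pedge D v = closed_segment (fst v) (fst (nxt D v))"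

lemma fst_edge: "fst ` edge D v = pedge D v"
  unfolding edge_def pedge_def by (rule closed_segment_linear_image[OF linear_fst, symmetric])

lemma plane_curve_eq: "plane_curve D = (\<Union>v\<in>verts D. pedge D v)"
  by (auto simp: plane_curve_def support_def fst_edge[symmetric])

text \<open>The radius is uniform over all directions in \<open>K\<close>; this, rather than one
  radius for each ray, is what allows the base point to be moved in
  \<open>germ_shift\<close>.\<close>

definition germ :: "link \<Rightarrow> complex \<Rightarrow> complex set \<Rightarrow> complex set \<Rightarrow> bool" where
  "germ D z K R \<longleftrightarrow> R \<in> regions D \<and> (\<exists>e>0. \<forall>x\<in>K. norm x < e \<longrightarrow> z + x \<in> R)"

text \<open>If z lies on the segment, every other point of it is seen from z in the direction of one
  of the ends, and a cone contains a vector together with its positive multiples. Otherwise the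
  segment, being closed, keeps a distance from z.\<close>

lemma closed_segment_avoids_cone:
  assumes K: "blunt_cone K" and z: "z \<in> closed_segment a b \<Longrightarrow> a - z \<notin> K \<and> b - z \<notin> K"
  shows "\<exists>e>0. \<forall>x\<in>K. norm x < e \<longrightarrow> z + x \<notin> closed_segment a b"
proof (cases "z \<in> closed_segment a b")
  case False
  then have "z \<in> - closed_segment a b" "open (- closed_segment a b)"
    by (auto simp: open_Compl)
  then obtain e where e: "e > 0" "ball z e \<subseteq> - closed_segment a b"
    by (meson open_contains_ball)
  have "z + x \<in> ball z e" if "norm x < e" for x
    using that by (simp add: dist_norm)
  then show ?thesis
    using e by blast
next
  case True
  then obtain s where s: "0 \<le> s" "s \<le> 1" "z = a + of_real s * (b - a)"
    by (auto simp: in_segment scaleR_conv_of_real algebra_simps)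
  have "z + x \<notin> closed_segment a b" if x: "x \<in> K" for x
  proof
    assume "z + x \<in> closed_segment a b"
    then obtain t where t: "0 \<le> t" "t \<le> 1" "z + x = a + of_real t * (b - a)"
      by (auto simp: in_segment scaleR_conv_of_real algebra_simps)
    have x_eq: "x = of_real (t - s) * (b - a)"
    proof -
      have "x = (a + of_real t * (b - a)) - z"
        using t(3) by (metis add_diff_cancel_left')
      then show ?thesis
        by (simp add: s(3) algebra_simps)
    qed
    have "x \<noteq> 0"
      using K x by (auto simp: blunt_cone_def)
    then have "t \<noteq> s"
      by (auto simp: x_eq)
    then consider "s < t" | "t < s"
      by linarith
    then show False
    proof cases
      case 1
      \<comment> \<open>The factor stretches x to the displacement from z to the end b.\<close>
      have "of_real ((1 - s) / (t - s)) * x = of_real ((1 - s) / (t - s) * (t - s)) * (b - a)"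
        by (simp only: x_eq of_real_mult mult.assoc)
      also have "(1 - s) / (t - s) * (t - s) = 1 - s"
        using 1 by simp
      also have "of_real (1 - s) * (b - a) = b - z"
        by (simp add: s(3) algebra_simps)
      finally have "b - z = of_real ((1 - s) / (t - s)) * x" ..
      moreover have "(1 - s) / (t - s) > 0"
        using 1 t by simp
      ultimately show False
        using K x z[OF True] by (auto simp: blunt_cone_def)
    next
      case 2
      have "of_real (s / (s - t)) * x = of_real (s / (s - t) * (t - s)) * (b - a)"
        by (simp only: x_eq of_real_mult mult.assoc)
      also have "s / (s - t) * (t - s) = - s"
        using 2 by (simp add: field_simps)
      also have "of_real (- s) * (b - a) = a - z"
        by (simp add: s(3) algebra_simps)
      finally have "a - z = of_real (s / (s - t)) * x" ..
      moreover have "s / (s - t) > 0"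
        using 2 t by simp
      ultimately show False
        using K x z[OF True] by (auto simp: blunt_cone_def)
    qed
  qed
  then show ?thesis
    using zero_less_one by blast
qed

lemma blunt_cone_small:
  assumes "blunt_cone K" "x \<in> K" "e > 0"
  obtains t where "t > 0" "of_real t * x \<in> K" "norm (of_real t * x) < e"
proof
  have "norm x > 0"
    using assms by (auto simp: blunt_cone_def)
  then show t: "e / (2 * norm x) > 0"
    using assms by simp
  then show "of_real (e / (2 * norm x)) * x \<in> K"
    using assms unfolding blunt_cone_def by blast
  show "norm (of_real (e / (2 * norm x)) * x) < e"
    using assms \<open>norm x > 0\<close> by (simp add: norm_mult norm_divide)
qed

text \<open>Finitely many edges admit a common radius, and the truncated cone is convex, so it lies
  in a single component.\<close>

lemma germ_exists:
  assumes fin: "finite (verts D)" and K: "blunt_cone K"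
    and z: "\<And>v. v \<in> verts D \<Longrightarrow> z \<in> pedge D v \<Longrightarrow> fst v - z \<notin> K \<and> fst (nxt D v) - z \<notin> K"
  shows "\<exists>R. germ D z K R"
proof -
  have "\<forall>\<^sub>F e in at_right 0. \<forall>x\<in>K. norm x < e \<longrightarrow> z + x \<notin> pedge D v" if v: "v \<in> verts D" for v
  proof -
    obtain e where e: "e > 0" "\<forall>x\<in>K. norm x < e \<longrightarrow> z + x \<notin> pedge D v"
      using closed_segment_avoids_cone[OF K, of z "fst v" "fst (nxt D v)"] z[OF v]
      by (auto simp: pedge_def)
    then have "\<forall>e'\<in>{0<..<e}. \<forall>x\<in>K. norm x < e' \<longrightarrow> z + x \<notin> pedge D v"
      by force
    then show ?thesis
      using e(1) eventually_at_right_real[OF e(1)] by (auto elim!: eventually_mono)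
  qed
  then have "\<forall>\<^sub>F e in at_right 0. \<forall>v\<in>verts D. \<forall>x\<in>K. norm x < e \<longrightarrow> z + x \<notin> pedge D v"
    using fin by (simp add: eventually_ball_finite)
  moreover have "\<forall>\<^sub>F e::real in at_right 0. e > 0"
    by (simp add: eventually_at_right_less)
  ultimately have "\<forall>\<^sub>F e in at_right 0. e > 0 \<and> (\<forall>v\<in>verts D. \<forall>x\<in>K. norm x < e \<longrightarrow> z + x \<notin> pedge D v)"
    by (simp add: eventually_conj)
  then obtain e where e: "e > 0" "\<And>v x. v \<in> verts D \<Longrightarrow> x \<in> K \<Longrightarrow> norm x < e \<Longrightarrow> z + x \<notin> pedge D v"
    using eventually_happens'[OF trivial_limit_at_right_real] by blast
  let ?T = "(+) z ` (K \<inter> ball 0 e)"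
  have "connected ?T"
    using K by (intro convex_connected convex_translation convex_Int) (auto simp: blunt_cone_def)
  moreover have sub: "?T \<subseteq> - plane_curve D"
    using e by (auto simp: plane_curve_eq)
  moreover obtain x where "x \<in> K"
    using K by (auto simp: blunt_cone_def)
  then obtain t where "of_real t * x \<in> K" "norm (of_real t * x) < e"
    using blunt_cone_small[OF K _ e(1)] by blast
  then have "z + of_real t * x \<in> ?T"
    by (intro imageI) auto
  ultimately obtain R where "R \<in> components (- plane_curve D)" "?T \<subseteq> R"
    by (metis (no_types, lifting) empty_iff exists_component_superset subset_empty)
  then show ?thesis
    using e(1) unfolding germ_def regions_def by force
qed

text \<open>A common direction, scaled down, leads to a point of both regions.\<close>

lemma germ_unique:
  assumes "germ D z K R" "germ D z K' R'" "x \<in> K" "x \<in> K'" "blunt_cone K" "blunt_cone K'"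
  shows "R = R'"
proof -
  obtain e e' where e: "e > 0" "\<And>x. x \<in> K \<Longrightarrow> norm x < e \<Longrightarrow> z + x \<in> R"
    "e' > 0" "\<And>x. x \<in> K' \<Longrightarrow> norm x < e' \<Longrightarrow> z + x \<in> R'"
    using assms(1,2) by (auto simp: germ_def)
  obtain t where t: "t > 0" "of_real t * x \<in> K" "norm (of_real t * x) < min e e'"
    using blunt_cone_small[OF assms(5,3), of "min e e'"] e by auto
  have "of_real t * x \<in> K'"
    using assms(4,6) t(1) by (auto simp: blunt_cone_def)
  then have "z + of_real t * x \<in> R \<inter> R'"
    using e t by auto
  then show ?thesis
    using assms(1,2) by (metis components_eq empty_iff germ_def regions_def)
qed

text \<open>The ray in direction d stays in R for a while, and regions are disjoint, so R is what
  the description in \<open>entered\<close> denotes.\<close>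

lemma corner_eq:
  assumes g: "germ D (crossing_point D c) K R" and d: "d \<in> K" and K: "blunt_cone K"
  shows "corner D c d = R"
  unfolding corner_def entered_def
proof (rule the_equality)
  let ?z = "crossing_point D c"
  obtain e where e: "e > 0" "\<And>x. x \<in> K \<Longrightarrow> norm x < e \<Longrightarrow> ?z + x \<in> R"
    using g by (auto simp: germ_def)
  have d0: "norm d > 0"
    using d K by (auto simp: blunt_cone_def)
  have "?z + of_real t * d \<in> R" if "t \<in> {0<..<e / norm d}" for t
    using that d K d0 by (intro e) (auto simp: blunt_cone_def norm_mult pos_less_divide_eq)
  moreover have "\<forall>\<^sub>F t in at_right 0. t \<in> {0<..<e / norm d}"
    using e d0 by (intro eventually_at_right_real) auto
  ultimately have ev: "\<forall>\<^sub>F t in at_right 0. ?z + of_real t * d \<in> R"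
    by (auto elim!: eventually_mono)
  then show "R \<in> regions D \<and> (\<forall>\<^sub>F t in at_right 0. ?z + of_real t * d \<in> R)"
    using g by (auto simp: germ_def)
  fix R' assume R': "R' \<in> regions D \<and> (\<forall>\<^sub>F t in at_right 0. ?z + of_real t * d \<in> R')"
  then have "\<forall>\<^sub>F t in at_right 0. ?z + of_real t * d \<in> R \<inter> R'"
    using ev by (auto intro: eventually_conj)
  then have "R \<inter> R' \<noteq> {}"
    using eventually_happens'[OF trivial_limit_at_right_real[of 0]] by blast
  then show "R' = R"
    using R' g by (metis components_eq germ_def regions_def)
qed

text \<open>Scaling turns a neighbourhood of the moved base point into one of p, so K has to contain
  the half plane bounded by the line of p only near p. In this way sectors at crossings and vertices
  yield half planes at neighbouring points of an edge.\<close>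

lemma germ_shift:
  assumes g: "germ D z K R" and K: "blunt_cone K" and q: "q = p \<or> q = - p"
    and U: "open U" "p \<in> U" and sub: "left_of q \<inter> U \<subseteq> K"
  shows "\<forall>\<^sub>F t in at_right 0. germ D (z + of_real t * p) (left_of q) R"
proof -
  obtain e where e: "e > 0" "\<And>x. x \<in> K \<Longrightarrow> norm x < e \<Longrightarrow> z + x \<in> R"
    using g by (auto simp: germ_def)
  obtain h where h: "h > 0" "ball p h \<subseteq> U"
    using U by (meson open_contains_ball)
  have "germ D (z + of_real t * p) (left_of q) R" if t: "t \<in> {0<..<e / (2 * (norm p + 1))}" for t
    unfolding germ_def
  proof (intro conjI exI ballI impI)
    show "R \<in> regions D"
      using g by (auto simp: germ_def)
    \<comment> \<open>The bound \<open>t * h\<close> shrinks with t to keep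
      \<open>x / of_real t\<close> shorter than h.\<close>
    show "min (e / 2) (t * h) > 0"
      using e h t by auto
    fix x assume x: "x \<in> left_of q" "norm x < min (e / 2) (t * h)"
    define y where "y = p + x / of_real t"
    have t0: "t > 0"
      using t by auto
    have y_eq: "of_real t * y = of_real t * p + x"
      using t by (simp add: y_def field_simps)
    have "norm (x / of_real t) < h"
      using x t by (simp add: norm_divide pos_divide_less_eq mult.commute)
    then have "y \<in> U"
      using h by (auto simp: y_def dist_norm)
    moreover have "of_real t * y \<in> left_of q"
      using x(1) q by (auto simp: y_eq mem_left_of)
    then have "y \<in> left_of q"
      using left_of_scale t0 by blast
    ultimately have "of_real t * y \<in> K"
      using sub K t0 by (auto simp: blunt_cone_def)
    moreover have "norm (of_real t * y) < e"
    proof -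
      have "norm (of_real t * p + x) \<le> norm (of_real t * p) + norm x"
        by (rule norm_triangle_ineq)
      also have "norm (of_real t * p) \<le> t * (norm p + 1)"
        using t by (simp add: norm_mult)
      also have "t * (norm p + 1) < e / 2"
        using t norm_ge_zero[of p] by (simp add: field_simps add_pos_nonneg)
      also have "norm x < e / 2"
        using x by simp
      finally show ?thesis
        by (simp add: y_eq)
    qed
    ultimately show "z + of_real t * p + x \<in> R"
      using e(2) by (simp add: y_eq add.assoc)
  qed
  moreover have "\<forall>\<^sub>F t in at_right 0. t \<in> {0<..<e / (2 * (norm p + 1))}"
    using e by (intro eventually_at_right_real) (auto simp: add_nonneg_pos)
  ultimately show ?thesis
    by (auto elim!: eventually_mono)
qed

section \<open>Projected edges, vertices and crossings\<close>

definition edge_point :: "link \<Rightarrow> point \<Rightarrow> real \<Rightarrow> complex" where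
  "edge_point D v t = fst v + of_real t * direction D v"

lemma edge_point_ends: "edge_point D v 0 = fst v" "edge_point D v 1 = fst (nxt D v)"
  by (simp_all add: edge_point_def direction_def)

lemma pedge_eq: "pedge D v = edge_point D v ` {0..1}"
  unfolding pedge_def closed_segment_image_interval
  by (intro image_cong) (auto simp: edge_point_def direction_def scaleR_conv_of_real algebra_simps)

lemma edge_point_in: "t \<in> {0..1} \<Longrightarrow> edge_point D v t \<in> pedge D v"
  by (simp add: pedge_eq)

lemma edge_point_shift: "edge_point D v (t + s) = edge_point D v t + of_real s * direction D v"
  by (simp add: edge_point_def algebra_simps)

locale diagram =
  fixes D :: link
  assumes oriented: "oriented_link D" and regular: "regular_position D"
begin

lemma finite_verts: "finite (verts D)"
  using oriented by (simp add: oriented_link_def)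

lemma permutes: "nxt D permutes verts D"
  using oriented by (simp add: oriented_link_def)

lemma nxt_in: "v \<in> verts D \<Longrightarrow> nxt D v \<in> verts D"
  using permutes by (simp add: permutes_in_image)

lemma nxt_neq: "v \<in> verts D \<Longrightarrow> nxt D v \<noteq> v"
  using oriented by (simp add: oriented_link_def)

lemma nxt_eq_iff: "nxt D u = nxt D v \<longleftrightarrow> u = v"
  using permutes by (metis permutes_inverses(2))

lemma edge_disjoint:
  "u \<in> verts D \<Longrightarrow> v \<in> verts D \<Longrightarrow> u \<noteq> v \<Longrightarrow> edge D u \<inter> edge D v \<subseteq> {nxt D u, nxt D v}"
  using oriented by (auto simp: oriented_link_def)

lemma edge_meet_vertex:
  assumes "u \<in> verts D" "v \<in> verts D" "u \<noteq> v" "x \<in> edge D u" "x \<in> edge D v"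
  shows "x \<in> verts D"
proof -
  have "x \<in> {nxt D u, nxt D v}"
    using edge_disjoint[OF assms(1-3)] assms(4,5) by blast
  then show ?thesis
    using nxt_in assms(1,2) by blast
qed

lemma edge_ends: "v \<in> edge D v" "nxt D v \<in> edge D v"
  by (simp_all add: edge_def)

lemma edge_support: "v \<in> verts D \<Longrightarrow> x \<in> edge D v \<Longrightarrow> x \<in> support D"
  by (auto simp: support_def)

lemma vertex_over: "v \<in> verts D \<Longrightarrow> x \<in> support D \<Longrightarrow> fst x = fst v \<Longrightarrow> x = v"
  using regular by (auto simp: regular_position_def)

lemma direction_neq: "v \<in> verts D \<Longrightarrow> direction D v \<noteq> 0"
  using vertex_over[of v "nxt D v"] nxt_neq edge_support edge_ends
  by (auto simp: direction_def)

lemma fst_inj_on_edge: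
  assumes "v \<in> verts D" "x \<in> edge D v" "y \<in> edge D v" "fst x = fst y"
  shows "x = y"
proof -
  obtain s t where st: "x = v + s *\<^sub>R (nxt D v - v)" "y = v + t *\<^sub>R (nxt D v - v)"
    using assms(2,3) by (auto simp: edge_def in_segment algebra_simps)
  then have "s *\<^sub>R direction D v = t *\<^sub>R direction D v"
    using assms(4) by (simp add: direction_def)
  then show ?thesis
    using direction_neq[OF assms(1)] st by simp
qed

text \<open>The projection identifies a vertex with no other point of the link, so the point of the
  edge above \<open>fst v\<close> is v itself.\<close>

lemma vertex_on_pedge:
  assumes "u \<in> verts D" "v \<in> verts D" "fst v \<in> pedge D u"
  shows "v \<in> edge D u" "v = u \<or> v = nxt D u"
proof -
  obtain x where "x \<in> edge D u" "fst x = fst v"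
    using assms(3) by (metis fst_edge imageE)
  then show v: "v \<in> edge D u"
    using vertex_over assms edge_support by metis
  show "v = u \<or> v = nxt D u"
    using edge_disjoint[OF assms(1,2)] v edge_ends(1)[of v] nxt_neq[OF assms(2)] by force
qed

lemma edge_point_inj: "v \<in> verts D \<Longrightarrow> edge_point D v s = edge_point D v t \<longleftrightarrow> s = t"
  using direction_neq by (auto simp: edge_point_def)

text \<open>
  Otherwise the projected edges overlap in a segment whose ends are projected vertices. Regular
  position lifts these to two common points of the edges in space.
\<close>

lemma pedge_inter_unique:
  assumes uv: "u \<in> verts D" "v \<in> verts D" "u \<noteq> v"
    and z: "z1 \<in> pedge D u" "z1 \<in> pedge D v" "z2 \<in> pedge D u" "z2 \<in> pedge D v"
  shows "z1 = z2"
proof (rule ccontr)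
  assume "z1 \<noteq> z2"
  obtain t1 t2 where t: "z1 = edge_point D u t1" "z2 = edge_point D u t2"
    "t1 \<in> {0..1}" "t2 \<in> {0..1}"
    using z(1,3) by (auto simp: pedge_eq)
  obtain s1 s2 where s: "z1 = edge_point D v s1" "z2 = edge_point D v s2"
    using z(2,4) by (auto simp: pedge_eq)
  have ne: "s1 \<noteq> s2"
    using \<open>z1 \<noteq> z2\<close> s by auto
  have "z2 - z1 = of_real (s2 - s1) * direction D v"
    by (simp add: s edge_point_def algebra_simps)
  moreover have "z2 - z1 = of_real (t2 - t1) * direction D u"
    by (simp add: t edge_point_def algebra_simps)
  ultimately have "of_real (s2 - s1) * direction D v = of_real (t2 - t1) * direction D u"
    by simp
  then have dir: "direction D v = of_real ((t2 - t1) / (s2 - s1)) * direction D u"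
    using ne by (simp add: field_simps)
  \<comment> \<open>Both edges lie on one line; f converts the parameter along v into the one along
    u.\<close>
  define f where "f s = t1 + (s - s1) * ((t2 - t1) / (s2 - s1))" for s
  have f: "edge_point D v s = edge_point D u (f s)" for s
  proof -
    have "edge_point D v s = edge_point D v s1 + of_real (s - s1) * direction D v"
      using edge_point_shift[of D v s1 "s - s1"] by simp
    also have "\<dots> = edge_point D u t1 + of_real ((s - s1) * ((t2 - t1) / (s2 - s1))) * direction D u"
      using s t by (simp add: dir)
    also have "\<dots> = edge_point D u (f s)"
      unfolding f_def by (rule edge_point_shift[symmetric])
    finally show ?thesis .
  qed
  have on_v: "edge_point D u t \<in> pedge D v \<longleftrightarrow> t \<in> closed_segment (f 0) (f 1)" for t
  proof -
    have "linear (\<lambda>t. of_real t * direction D u)"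
      by (intro linearI) (auto simp: algebra_simps scaleR_conv_of_real)
    then have "(\<lambda>t. of_real t * direction D u) ` closed_segment (f 0) (f 1) =
        closed_segment (of_real (f 0) * direction D u) (of_real (f 1) * direction D u)"
      by (rule closed_segment_linear_image[symmetric])
    moreover have "pedge D v = closed_segment (edge_point D u (f 0)) (edge_point D u (f 1))"
      using f[of 0] f[of 1] by (simp add: pedge_def edge_point_ends)
    ultimately have "pedge D v = edge_point D u ` closed_segment (f 0) (f 1)"
      unfolding edge_point_def closed_segment_translation image_comp[symmetric]
      by (metis (no_types, lifting) image_cong image_image)
    then show ?thesis
      using edge_point_inj[OF uv(1)] by auto
  qed
  \<comment> \<open>The overlap of the projected edges, in the parameter along u, runs from l to
    m.\<close>
  define l m where "l = max 0 (min (f 0) (f 1))" and "m = min 1 (max (f 0) (f 1))"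
  have lm: "l \<le> t \<and> t \<le> m" if "t = t1 \<or> t = t2" for t
    using on_v[of t] that z t by (auto simp: l_def m_def closed_segment_eq_real_ivl split: if_splits)
  have "t1 \<noteq> t2"
    using \<open>z1 \<noteq> z2\<close> t by auto
  then have "l < m"
    using lm[of t1] lm[of t2] by auto
  then have lmI: "l \<in> {0..1} \<inter> closed_segment (f 0) (f 1)" "m \<in> {0..1} \<inter> closed_segment (f 0) (f 1)"
    by (auto simp: l_def m_def closed_segment_eq_real_ivl)
  have end_vertex: "\<exists>p. p \<in> edge D u \<inter> edge D v \<and> fst p = edge_point D u r"
    if r: "r \<in> {0..1} \<inter> closed_segment (f 0) (f 1)" "r \<in> {0, 1, f 0, f 1}" for r
  proof -
    have "\<exists>p\<in>{u, nxt D u, v, nxt D v}. fst p = edge_point D u r"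
      using r(2) edge_point_ends[of D u] edge_point_ends[of D v] f[of 0] f[of 1] by auto
    moreover have "{u, nxt D u, v, nxt D v} \<subseteq> verts D"
      using uv nxt_in by simp
    ultimately obtain p where p: "p \<in> verts D" "fst p = edge_point D u r"
      by blast
    moreover have "edge_point D u r \<in> pedge D u" "edge_point D u r \<in> pedge D v"
      using r on_v by (auto simp: pedge_eq[of D u])
    ultimately show ?thesis
      using vertex_on_pedge(1) uv by (metis IntI)
  qed
  obtain p q where pq: "p \<in> edge D u \<inter> edge D v" "q \<in> edge D u \<inter> edge D v"
    "fst p = edge_point D u l" "fst q = edge_point D u m"
  proof -
    have "l \<in> {0, 1, f 0, f 1}" "m \<in> {0, 1, f 0, f 1}"
      by (simp_all add: l_def m_def min_def max_def)
    then show ?thesis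
      using that end_vertex[OF lmI(1)] end_vertex[OF lmI(2)] by blast
  qed
  have "p \<noteq> q"
    using pq(3,4) \<open>l < m\<close> edge_point_inj[OF uv(1)] by auto
  \<comment> \<open>The segment between the two lifts lies in both edges, which share at most two
    points.\<close>
  have "convex (edge D u \<inter> edge D v)"
    by (auto simp: edge_def intro!: convex_Int)
  then have "closed_segment p q \<subseteq> edge D u \<inter> edge D v"
    using pq(1,2) by (intro closed_segment_subset)
  then have "closed_segment p q \<subseteq> {nxt D u, nxt D v}"
    using edge_disjoint[OF uv] by (rule subset_trans)
  then have "finite (closed_segment p q)"
    by (rule finite_subset) simp
  then show False
    using \<open>p \<noteq> q\<close> by (simp add: finite_closed_segment)
qed

text \<open>At these points the diagram is locally a line, so both half planes along the edge carry
  germs.\<close>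

definition free_params :: "point \<Rightarrow> real set" where
  "free_params v = {t \<in> {0<..<1}. \<forall>u\<in>verts D. u \<noteq> v \<longrightarrow> edge_point D v t \<notin> pedge D u}"

lemma interior_not_vertex:
  assumes "v \<in> verts D" "u \<in> verts D" "t \<in> {0<..<1}"
  shows "edge_point D v t \<noteq> fst u"
proof
  assume *: "edge_point D v t = fst u"
  have "edge_point D v t \<in> pedge D v"
    unfolding pedge_eq using assms(3) by (intro imageI) auto
  then have "u = v \<or> u = nxt D v"
    using vertex_on_pedge(2)[OF assms(1,2)] * by simp
  then have "edge_point D v t = edge_point D v 0 \<or> edge_point D v t = edge_point D v 1"
    using * by (auto simp: edge_point_ends)
  then show False
    using edge_point_inj assms by auto
qed

lemma nonvertex_interior:
  assumes "v \<in> verts D" "z \<in> pedge D v" "z \<notin> fst ` verts D"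
  obtains t where "t \<in> {0<..<1}" "z = edge_point D v t"
proof -
  obtain t where t: "t \<in> {0..1}" "z = edge_point D v t"
    using assms by (auto simp: pedge_eq)
  then have "t \<noteq> 0" "t \<noteq> 1"
    using assms(1,3) edge_point_ends[of D v] nxt_in by (metis imageI)+
  then have "t \<in> {0<..<1}"
    using t(1) by auto
  then show ?thesis
    using t(2) that by blast
qed

text \<open>Parallel edges that meet at interior points would overlap in a segment, against
  \<open>pedge_inter_unique\<close>.\<close>

lemma not_parallel:
  assumes uv: "u \<in> verts D" "v \<in> verts D" "u \<noteq> v"
    and st: "s \<in> {0<..<1}" "t \<in> {0<..<1}" "edge_point D u s = edge_point D v t"
  shows "wedge (direction D u) (direction D v) \<noteq> 0"
proof
  let ?d = "direction D u" and ?e = "direction D v"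
  assume "wedge ?d ?e = 0"
  then obtain k where k: "?e = of_real k * ?d"
    using wedge_eq_0 direction_neq[OF uv(1)] by blast
  have "k \<noteq> 0"
    using direction_neq[OF uv(2)] k by auto
  \<comment> \<open>A step small enough to keep both \<open>t + h\<close> along v and
    \<open>s + h * k\<close> along u in the unit interval.\<close>
  define h where "h = min (1 - t) ((if k > 0 then 1 - s else s) / \<bar>k\<bar>)"
  have h: "h > 0" "h \<le> 1 - t" "h \<le> (if k > 0 then 1 - s else s) / \<bar>k\<bar>"
    using st \<open>k \<noteq> 0\<close> by (auto simp: h_def)
  have "s + h * k \<in> {0..1}"
  proof (cases "k > 0")
    case True
    then have "h * k \<le> 1 - s" "h * k > 0"
      using h by (auto simp: field_simps)
    then show ?thesis
      using st by auto
  next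
    case False
    then have "- (h * k) \<le> s" "h * k < 0"
      using h \<open>k \<noteq> 0\<close> by (auto simp: field_simps mult_pos_neg)
    then show ?thesis
      using st by auto
  qed
  moreover have "t + h \<in> {0..1}"
    using h st by auto
  moreover have eq: "edge_point D v (t + h) = edge_point D u (s + h * k)"
    using st(3) by (simp add: edge_point_shift k)
  ultimately have "edge_point D v (t + h) \<in> pedge D u" "edge_point D v (t + h) \<in> pedge D v"
    by (metis edge_point_in)+
  moreover have "edge_point D v t \<in> pedge D u" "edge_point D v t \<in> pedge D v"
    using st by (metis edge_point_in greaterThanLessThan_subseteq_atLeastAtMost_iff order_refl subset_eq)+
  ultimately have "edge_point D v (t + h) = edge_point D v t"
    using pedge_inter_unique[OF uv] by blast
  then show False
    using edge_point_inj[OF uv(2)] h by simp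
qed

text \<open>A third edge through the point would either contribute a third preimage or share one
  with a or b, and edges share only vertices; regular position excludes both.\<close>

lemma crossing_cases:
  assumes "(a, b) \<in> crossings D"
  obtains s t where "a \<in> verts D" "b \<in> verts D" "a \<noteq> b" "s \<in> {0<..<1}" "t \<in> {0<..<1}"
    "crossing_point D (a, b) = edge_point D a s" "crossing_point D (a, b) = edge_point D b t"
    "\<And>v. v \<in> verts D \<Longrightarrow> crossing_point D (a, b) \<in> pedge D v \<Longrightarrow> v = a \<or> v = b"
    "crossing_point D (a, b) \<notin> fst ` verts D"
proof -
  obtain x y where ab: "a \<in> verts D" "b \<in> verts D" "x \<in> edge D a" "y \<in> edge D b"
    "fst x = fst y" "snd x > snd y"
    using assms by (auto simp: crossings_def)
  have ne: "a \<noteq> b"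
    using fst_inj_on_edge ab by fastforce
  have z: "fst x \<in> pedge D a" "fst x \<in> pedge D b"
    using ab by (metis fst_edge imageI)+
  have cp: "crossing_point D (a, b) = fst x"
    unfolding crossing_point_def fst_conv snd_conv fst_edge
    using z pedge_inter_unique[OF ab(1,2) ne] by blast
  have supp: "x \<in> support D" "y \<in> support D"
    using ab edge_support by auto
  have nv: "fst x \<notin> fst ` verts D"
    using vertex_over supp ab(5,6) by (metis imageE less_irrefl)
  have only: "v = a \<or> v = b" if v: "v \<in> verts D" "fst x \<in> pedge D v" for v
  proof (rule ccontr)
    assume *: "\<not> (v = a \<or> v = b)"
    obtain x' where x': "x' \<in> edge D v" "fst x' = fst x"
      using v(2) by (metis fst_edge imageE)
    let ?F = "{w \<in> support D. fst w = fst x}"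
    have F: "finite ?F" "card ?F \<le> 2"
      using regular by (auto simp: regular_position_def)
    have "x' = x \<or> x' = y"
    proof (rule ccontr)
      assume "\<not> (x' = x \<or> x' = y)"
      moreover have "x \<noteq> y"
        using ab(6) by blast
      ultimately have "card {x, y, x'} = 3"
        by (metis card_3_iff)
      moreover have "{x, y, x'} \<subseteq> ?F"
        using supp x' ab edge_support v by auto
      ultimately show False
        using card_mono[OF F(1), of "{x, y, x'}"] F(2) by simp
    qed
    moreover have "x' \<notin> verts D"
      using nv x'(2) by (metis imageI)
    moreover have "x' \<noteq> x"
      using edge_meet_vertex[OF v(1) ab(1)] * x'(1) ab(3) \<open>x' \<notin> verts D\<close> by blast
    moreover have "x' \<noteq> y"
      using edge_meet_vertex[OF v(1) ab(2)] * x'(1) ab(4) \<open>x' \<notin> verts D\<close> by blast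
    ultimately show False
      by blast
  qed
  obtain s where "s \<in> {0<..<1}" "fst x = edge_point D a s"
    using nonvertex_interior[OF ab(1) z(1) nv] by blast
  moreover obtain t where "t \<in> {0<..<1}" "fst x = edge_point D b t"
    using nonvertex_interior[OF ab(2) z(2) nv] by blast
  ultimately show thesis
    using that[of s t] ab ne cp only nv by simp
qed

text \<open>Distinct edges meet in space only at vertices, so away from these the two heights
  differ, and their order tells the over-edge.\<close>

lemma double_point_crossing:
  assumes uv: "u \<in> verts D" "v \<in> verts D" "u \<noteq> v"
    and z: "z \<in> pedge D u" "z \<in> pedge D v" "z \<notin> fst ` verts D"
  shows "(u, v) \<in> crossings D \<and> crossing_point D (u, v) = z \<or>
    (v, u) \<in> crossings D \<and> crossing_point D (v, u) = z"
proof -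
  obtain x y where xy: "x \<in> edge D u" "y \<in> edge D v" "fst x = z" "fst y = z"
    using z by (metis fst_edge imageE)
  have "x \<noteq> y"
  proof
    assume "x = y"
    then have "x \<in> verts D"
      using edge_meet_vertex[OF uv] xy by blast
    then show False
      using z(3) xy(3) by blast
  qed
  then have "snd x \<noteq> snd y"
    using xy by (simp add: prod_eq_iff)
  moreover have "crossing_point D (u, v) = z" "crossing_point D (v, u) = z"
    unfolding crossing_point_def fst_conv snd_conv fst_edge
    using z pedge_inter_unique[OF uv] by blast+
  ultimately show ?thesis
    using xy uv by (auto simp: crossings_def) (metis linorder_neqE_linordered_idom)
qed

lemma finite_crossings: "finite (crossings D)"
  by (rule finite_subset[of _ "verts D \<times> verts D"]) (auto simp: crossings_def finite_verts)

end

section \<open>Jumps of a coloring across the edges\<close>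

lemma left_of_real_scale:
  "k > 0 \<Longrightarrow> left_of (of_real k * d) = left_of d"
  "k < 0 \<Longrightarrow> left_of (of_real k * d) = left_of (- d)"
  by (auto simp: mem_left_of zero_less_mult_iff)

lemma real_multiple_not_left_of: "of_real r * p \<notin> left_of (of_real k * p)"
  by (simp add: mem_left_of)

text \<open>The open convex sector spanned by p and q. The factor \<open>wedge p q\<close> matters
  only by its sign: it orients both half planes, whichever of p and q comes first
  counterclockwise.\<close>

definition sector :: "complex \<Rightarrow> complex \<Rightarrow> complex set" where
  "sector p q = left_of (of_real (wedge p q) * p) \<inter> left_of (of_real (- wedge p q) * q)"

lemma sector_commute: "sector p q = sector q p"
  using wedge_commute[of q p] by (auto simp: sector_def)

lemma mult_self_pos: "k \<noteq> 0 \<Longrightarrow> k * k > (0::real)"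
  by (metis not_real_square_gt_zero)

lemma add_mem_sector: "wedge p q \<noteq> 0 \<Longrightarrow> p + q \<in> sector p q"
  using wedge_commute[of q p] by (simp add: sector_def mem_left_of mult_self_pos)

lemma blunt_cone_sector:
  assumes "wedge p q \<noteq> 0"
  shows "blunt_cone (sector p q)"
  using add_mem_sector[OF assms] assms unfolding sector_def
  by (intro blunt_cone_Int blunt_cone_left_of) auto

lemma real_multiple_not_sector: "of_real r * p \<notin> sector p q" "of_real r * q \<notin> sector p q"
  by (simp_all add: sector_def mem_left_of)

lemma eventually_at_two_sided:
  fixes a :: real
  assumes "\<forall>\<^sub>F s in at_right 0. P (a + s)" "\<forall>\<^sub>F s in at_right 0. P (a - s)"
  shows "\<forall>\<^sub>F t in at a. P t"
proof -
  obtain b c where b: "b > 0" "\<And>s. s > 0 \<Longrightarrow> s < b \<Longrightarrow> P (a + s)"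
    and c: "c > 0" "\<And>s. s > 0 \<Longrightarrow> s < c \<Longrightarrow> P (a - s)"
    using assms unfolding eventually_at_right_field by auto
  have "P t" if "t \<noteq> a" "dist t a < min b c" for t
    using b(2)[of "t - a"] c(2)[of "a - t"] that by (cases "t > a") (auto simp: dist_real_def)
  then show ?thesis
    unfolding eventually_at using b(1) c(1) by (intro exI[of _ "min b c"]) auto
qed

text \<open>A locally constant function on a connected set is constant, here for values visible only
  in punctured neighbourhoods, because crossings have no value of their own. The sets
  \<open>U b\<close> are open and pairwise disjoint.\<close>

lemma connected_eventually_const:
  fixes I :: "'a::t1_space set"
  assumes conn: "connected I"
    and loc: "\<And>t. t \<in> I \<Longrightarrow> \<exists>b. \<forall>\<^sub>F s in at t. P s b"
    and uniq: "\<And>t b b'. \<forall>\<^sub>F s in at t. P s b \<Longrightarrow> \<forall>\<^sub>F s in at t. P s b' \<Longrightarrow> b = b'"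
  shows "\<exists>b. \<forall>t\<in>I. \<forall>\<^sub>F s in at t. P s b"
proof (cases "I = {}")
  case False
  then obtain t0 b0 where t0: "t0 \<in> I" "\<forall>\<^sub>F s in at t0. P s b0"
    using loc by blast
  define U where "U b = {t. \<forall>\<^sub>F s in at t. P s b}" for b
  have "open (U b)" for b
  proof (subst open_subopen, intro ballI)
    fix t assume "t \<in> U b"
    then obtain S where S: "open S" "t \<in> S" "\<And>s. s \<in> S \<Longrightarrow> s \<noteq> t \<Longrightarrow> P s b"
      by (auto simp: U_def eventually_at_topological)
    have "x \<in> U b" if "x \<in> S" for x
    proof (cases "x = t")
      case False
      then have "open (S - {t})" "x \<in> S - {t}"
        using S that by auto
      then show ?thesis
        using S(3) unfolding U_def eventually_at_topological by blast
    qed (use \<open>t \<in> U b\<close> in simp)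
    then show "\<exists>T. open T \<and> t \<in> T \<and> T \<subseteq> U b"
      using S by blast
  qed
  moreover have "U b \<inter> U b' = {}" if "b \<noteq> b'" for b b'
    using uniq that by (auto simp: U_def)
  moreover have "I \<subseteq> U b0 \<union> (\<Union>b\<in>- {b0}. U b)"
  proof
    fix t assume "t \<in> I"
    then obtain b where "t \<in> U b"
      using loc by (auto simp: U_def)
    then show "t \<in> U b0 \<union> (\<Union>b\<in>- {b0}. U b)"
      by (cases "b = b0") auto
  qed
  ultimately have "U b0 \<inter> I = {} \<or> (\<Union>b\<in>- {b0}. U b) \<inter> I = {}"
    by (intro connectedD[OF conn] open_UN ballI) auto
  then have "I \<subseteq> U b0"
    using t0 \<open>I \<subseteq> _\<close> by (auto simp: U_def)
  then show ?thesis
    by (auto simp: U_def)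
qed simp

section \<open>The color difference across an edge, also near crossings and vertices\<close>

context diagram
begin

text \<open>A relation, since at a crossing the half planes carry no germs. In \<open>bit\<close> a
  sum is a difference, so the value 1 means that the colors differ.\<close>

definition across :: "(complex set \<Rightarrow> bit) \<Rightarrow> point \<Rightarrow> real \<Rightarrow> bit \<Rightarrow> bool" where
  "across C v t b \<longleftrightarrow> (\<exists>R R'. germ D (edge_point D v t) (left_of (direction D v)) R \<and>
     germ D (edge_point D v t) (left_of (- direction D v)) R' \<and> C R + C R' = b)"

lemma acrossI:
  assumes "germ D (edge_point D v t) (left_of (direction D v)) R"
    "germ D (edge_point D v t) (left_of (- direction D v)) R'"
  shows "across C v t (C R + C R')"
  unfolding across_def using assms by (intro exI conjI) (assumption, assumption, rule refl)

lemma left_of_direction: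
  assumes "v \<in> verts D"
  shows "blunt_cone (left_of (direction D v))" "blunt_cone (left_of (- direction D v))"
    "\<i> * direction D v \<in> left_of (direction D v)" "- (\<i> * direction D v) \<in> left_of (- direction D v)"
  using direction_neq[OF assms] left_of_rotated[of "direction D v"] left_of_rotated[of "- direction D v"]
  by (simp_all add: blunt_cone_left_of)

lemma across_unique:
  assumes "v \<in> verts D" "across C v t b" "across C v t b'"
  shows "b = b'"
  using assms germ_unique left_of_direction[OF assms(1)] unfolding across_def by metis

lemma ends_minus_edge_point:
  "fst v - edge_point D v t = of_real (- t) * direction D v"
  "fst (nxt D v) - edge_point D v t = of_real (1 - t) * direction D v"
  by (simp_all add: edge_point_def direction_def algebra_simps)

lemma across_exists:
  assumes v: "v \<in> verts D" and t: "t \<in> free_params v"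
  shows "\<exists>b. across C v t b"
proof -
  have "\<exists>R. germ D (edge_point D v t) (left_of (of_real k * direction D v)) R" if "k \<noteq> 0" for k
  proof (rule germ_exists[OF finite_verts])
    show "blunt_cone (left_of (of_real k * direction D v))"
      using direction_neq[OF v] that by (intro blunt_cone_left_of) auto
    fix u assume "u \<in> verts D" "edge_point D v t \<in> pedge D u"
    then have "u = v"
      using t by (auto simp: free_params_def)
    then show "fst u - edge_point D v t \<notin> left_of (of_real k * direction D v) \<and>
        fst (nxt D u) - edge_point D v t \<notin> left_of (of_real k * direction D v)"
      by (simp only: ends_minus_edge_point real_multiple_not_left_of not_False_eq_True)
  qed
  from this[of 1] this[of "- 1"] obtain R R' where
    "germ D (edge_point D v t) (left_of (direction D v)) R"
    "germ D (edge_point D v t) (left_of (- direction D v)) R'"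
    by auto
  then show ?thesis
    unfolding across_def by blast
qed

text \<open>Germs in cones on the two sides of an edge become half plane germs a little further
  along it (\<open>e = 1\<close>) or back (\<open>e = - 1\<close>). The sign of k tells which cone
  lies on the left; the sum of the colors does not depend on it.\<close>

lemma across_shift:
  assumes v: "v \<in> verts D" and e: "e = 1 \<or> e = - 1" and k: "k \<noteq> 0"
    and R: "germ D (edge_point D v t) K R" "germ D (edge_point D v t) K' R'"
    and K: "blunt_cone K" "blunt_cone K'"
    and U: "open U" "of_real e * direction D v \<in> U"
      "left_of (of_real k * direction D v) \<inter> U \<subseteq> K"
      "left_of (of_real (- k) * direction D v) \<inter> U \<subseteq> K'"
  shows "\<forall>\<^sub>F s in at_right 0. across C v (t + e * s) (C R + C R')"
proof -
  have 1: "\<forall>\<^sub>F s in at_right 0. across C v (t + e * s) (C R + C R')"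
    if R: "germ D (edge_point D v t) K R" "germ D (edge_point D v t) K' R'"
    and K: "blunt_cone K" "blunt_cone K'"
    and UK: "left_of (direction D v) \<inter> U \<subseteq> K" "left_of (- direction D v) \<inter> U \<subseteq> K'"
    for K K' R R'
  proof -
    have pt: "edge_point D v t + of_real s * (of_real e * direction D v) = edge_point D v (t + e * s)" for s
      by (simp add: edge_point_shift mult_ac)
    have q: "direction D v = of_real e * direction D v \<or> direction D v = - (of_real e * direction D v)"
      "- direction D v = of_real e * direction D v \<or> - direction D v = - (of_real e * direction D v)"
      using e by auto
    show ?thesis
      using germ_shift[OF R(1) K(1) q(1) U(1,2) UK(1)] germ_shift[OF R(2) K(2) q(2) U(1,2) UK(2)]
      unfolding pt by eventually_elim (rule acrossI)
  qed
  show ?thesis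
  proof (cases "k > 0")
    case True
    then have "left_of (direction D v) \<inter> U \<subseteq> K" "left_of (- direction D v) \<inter> U \<subseteq> K'"
      using U(3,4) left_of_real_scale(1)[of k] left_of_real_scale(2)[of "- k"] by auto
    then show ?thesis
      by (rule 1[OF R K])
  next
    case False
    then have "k < 0"
      using k by simp
    then have "left_of (direction D v) \<inter> U \<subseteq> K'" "left_of (- direction D v) \<inter> U \<subseteq> K"
      using U(3,4) left_of_real_scale(1)[of "- k"] left_of_real_scale(2)[of k] by auto
    then show ?thesis
      unfolding add.commute[of "C R"] by (rule 1[OF R(2,1) K(2,1)])
  qed
qed

lemma free_params_across:
  assumes "v \<in> verts D" "t \<in> free_params v" "across C v t b"
  shows "\<forall>\<^sub>F s in at t. across C v s b"
proof -
  obtain R R' where R: "germ D (edge_point D v t) (left_of (direction D v)) R"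
    "germ D (edge_point D v t) (left_of (- direction D v)) R'" "C R + C R' = b"
    using assms(3) by (auto simp: across_def)
  have "\<forall>\<^sub>F s in at_right 0. across C v (t + e * s) b" if "e = 1 \<or> e = - 1" for e
    unfolding R(3)[symmetric]
    by (rule across_shift[OF assms(1) that _ R(1,2) left_of_direction(1,2)[OF assms(1)], of 1 UNIV]) auto
  from this[of 1] this[of "- 1"] show ?thesis
    by (intro eventually_at_two_sided) simp_all
qed

text \<open>The two sectors adjacent to the ray p look like half planes near p; \<open>?U\<close> is
  the side of the line of q that contains p.\<close>

lemma across_sectors:
  assumes v: "v \<in> verts D" and e: "e = 1 \<or> e = - 1"
    and p: "p = of_real e * direction D v" and q: "wedge p q \<noteq> 0"
    and R: "germ D (edge_point D v t) (sector p q) R" "germ D (edge_point D v t) (sector p (- q)) R'"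
  shows "\<forall>\<^sub>F s in at_right 0. across C v (t + e * s) (C R + C R')"
proof (rule across_shift[OF v e _ R])
  let ?k = "wedge p q"
  let ?U = "left_of (of_real (- ?k) * q)"
  show "e * ?k \<noteq> 0"
    using e q by auto
  show "blunt_cone (sector p q)" "blunt_cone (sector p (- q))"
    using q by (auto intro!: blunt_cone_sector)
  show "open ?U"
    by (rule open_left_of)
  show "of_real e * direction D v \<in> ?U"
    unfolding p[symmetric] using q wedge_commute[of q p] by (simp add: mem_left_of mult_self_pos)
  have ed: "of_real (e * ?k) * direction D v = of_real ?k * p"
    "of_real (- (e * ?k)) * direction D v = of_real (- ?k) * p"
    by (simp_all add: p)
  show "left_of (of_real (e * ?k) * direction D v) \<inter> ?U \<subseteq> sector p q"
    by (simp only: ed sector_def order_refl)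
  show "left_of (of_real (- (e * ?k)) * direction D v) \<inter> ?U \<subseteq> sector p (- q)"
    unfolding ed by (simp add: sector_def)
qed

text \<open>Only a and b pass through the crossing, and their ends lie on the lines of p and q,
  hence outside the open sector.\<close>

lemma crossing_germs:
  assumes c: "(a, b) \<in> crossings D"
    and p: "p = direction D a \<or> p = - direction D a"
    and q: "q = direction D b \<or> q = - direction D b"
  shows "\<exists>R. germ D (crossing_point D (a, b)) (sector p q) R \<and> corner D (a, b) (p + q) = R"
    and "wedge p q \<noteq> 0"
proof -
  obtain s t where ab: "a \<in> verts D" "b \<in> verts D" "a \<noteq> b" "s \<in> {0<..<1}" "t \<in> {0<..<1}"
    and z: "crossing_point D (a, b) = edge_point D a s" "crossing_point D (a, b) = edge_point D b t"
    and only: "\<And>v. v \<in> verts D \<Longrightarrow> crossing_point D (a, b) \<in> pedge D v \<Longrightarrow> v = a \<or> v = b"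
    using crossing_cases[OF c] by metis
  have "wedge (direction D a) (direction D b) \<noteq> 0"
    using not_parallel[OF ab] z by simp
  then show nz: "wedge p q \<noteq> 0"
    using p q by auto
  have "\<exists>R. germ D (crossing_point D (a, b)) (sector p q) R"
  proof (rule germ_exists[OF finite_verts blunt_cone_sector[OF nz]])
    fix v assume "v \<in> verts D" "crossing_point D (a, b) \<in> pedge D v"
    then have v: "v = a \<or> v = b"
      by (rule only)
    have "\<exists>r. fst v - crossing_point D (a, b) = of_real r * p \<or> fst v - crossing_point D (a, b) = of_real r * q"
      using v z ends_minus_edge_point(1)[of a s] ends_minus_edge_point(1)[of b t] p q
      by (metis minus_mult_minus of_real_minus)
    moreover have "\<exists>r. fst (nxt D v) - crossing_point D (a, b) = of_real r * p \<or>
        fst (nxt D v) - crossing_point D (a, b) = of_real r * q"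
      using v z ends_minus_edge_point(2)[of a s] ends_minus_edge_point(2)[of b t] p q
      by (metis minus_mult_minus of_real_minus)
    ultimately show "fst v - crossing_point D (a, b) \<notin> sector p q \<and>
        fst (nxt D v) - crossing_point D (a, b) \<notin> sector p q"
      using real_multiple_not_sector by metis
  qed
  then show "\<exists>R. germ D (crossing_point D (a, b)) (sector p q) R \<and> corner D (a, b) (p + q) = R"
    using corner_eq[OF _ add_mem_sector[OF nz] blunt_cone_sector[OF nz]] by blast
qed

text \<open>Here the coloring rule enters: with the right color x + y - z, the differences across
  the over-strand ahead of and behind the crossing are both x + z, and those across the under-strand
  both x + y.\<close>

lemma crossing_jumps:
  assumes C: "C \<in> Col D" and c: "(a, b) \<in> crossings D"
    and st: "crossing_point D (a, b) = edge_point D a s" "crossing_point D (a, b) = edge_point D b t"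
    and xyz: "color_triple D C (a, b) = (x, y, z)"
  shows "\<forall>\<^sub>F s' in at s. across C a s' (x + z)" "\<forall>\<^sub>F t' in at t. across C b t' (x + y)"
proof -
  let ?o = "direction D a" and ?u = "direction D b" and ?z = "crossing_point D (a, b)"
  obtain R1 where R1: "germ D ?z (sector ?o ?u) R1" "corner D (a, b) (?o + ?u) = R1"
    using crossing_germs[OF c] by blast
  obtain R2 where R2: "germ D ?z (sector (- ?o) ?u) R2" "corner D (a, b) (?u - ?o) = R2"
    using crossing_germs[OF c, of "- ?o" ?u] by auto
  obtain R3 where R3: "germ D ?z (sector (- ?o) (- ?u)) R3" "corner D (a, b) (- ?o - ?u) = R3"
    using crossing_germs[OF c, of "- ?o" "- ?u"] by auto
  obtain R4 where R4: "germ D ?z (sector ?o (- ?u)) R4" "corner D (a, b) (?o - ?u) = R4"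
    using crossing_germs[OF c, of "?o" "- ?u"] by auto
  have ab: "a \<in> verts D" "b \<in> verts D"
    using c by (auto simp: crossings_def)
  have nz: "wedge p q \<noteq> 0" "wedge q p \<noteq> 0"
    if "p = ?o \<or> p = - ?o" "q = ?u \<or> q = - ?u" for p q
    using crossing_germs(2)[OF c that] wedge_commute[of q p] by auto
  have rel: "C (right_region D (a, b)) = x + y - z"
    using C c xyz by (auto simp: Col_def ternary_def)
  \<comment> \<open>The left corner is \<open>R4\<close> at a positive crossing and
    \<open>R2\<close> at a negative one; the sums come out alike.\<close>
  have sums: "C R1 + C R4 = x + z \<and> C R2 + C R3 = x + z \<and> C R1 + C R2 = x + y \<and> C R4 + C R3 = x + y"
  proof (cases "crossing_sign D (a, b) = 1")
    case True
    then have "x = C R4" "y = C R3" "z = C R1" "C R2 = x + y - z"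
      using xyz rel R1(2) R2(2) R3(2) R4(2)
      by (auto simp: color_triple_def left_region_def right_region_def top_region_def
          bottom_region_def over_dir_def under_dir_def)
    then show ?thesis
      by (cases x; cases y; cases z) auto
  next
    case False
    then have "x = C R2" "y = C R1" "z = C R3" "C R4 = x + y - z"
      using xyz rel R1(2) R2(2) R3(2) R4(2)
      by (auto simp: color_triple_def left_region_def right_region_def top_region_def
          bottom_region_def over_dir_def under_dir_def)
    then show ?thesis
      by (cases x; cases y; cases z) auto
  qed
  note R = R1(1) R2(1) R3(1) R4(1)
  note Ra = R[unfolded st(1)] and Rb = R[unfolded st(2)]
  have "\<forall>\<^sub>F h in at_right 0. across C a (s + h) (x + z)"
    using across_sectors[OF ab(1) _ _ _ Ra(1,4), of 1 C] nz(1)[of ?o ?u] sums by simp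
  moreover have "\<forall>\<^sub>F h in at_right 0. across C a (s - h) (x + z)"
    using across_sectors[OF ab(1) _ _ _ Ra(2,3), of "- 1" C] nz(1)[of "- ?o" ?u] sums by simp
  ultimately show "\<forall>\<^sub>F s' in at s. across C a s' (x + z)"
    by (rule eventually_at_two_sided)
  have "\<forall>\<^sub>F h in at_right 0. across C b (t + h) (x + y)"
    using across_sectors[OF ab(2) _ _ _ Rb(1,2)[unfolded sector_commute[of _ ?u]], of 1 C]
      nz(2)[of ?o ?u] sums by simp
  moreover have "\<forall>\<^sub>F h in at_right 0. across C b (t - h) (x + y)"
    using across_sectors[OF ab(2) _ _ _ Rb(4,3)[unfolded sector_commute[of _ "- ?u"]], of "- 1" C]
      nz(2)[of ?o "- ?u"] sums by simp
  ultimately show "\<forall>\<^sub>F t' in at t. across C b t' (x + y)"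
    by (rule eventually_at_two_sided)
qed

lemma vertex_germ:
  assumes uv: "u \<in> verts D" "v \<in> verts D" "nxt D u = v"
    and K: "blunt_cone K" "- direction D u \<notin> K" "direction D v \<notin> K"
  shows "\<exists>R. germ D (fst v) K R"
proof (rule germ_exists[OF finite_verts K(1)])
  fix w assume w: "w \<in> verts D" "fst v \<in> pedge D w"
  then have "w = v \<or> w = u"
    using vertex_on_pedge(2)[OF w(1) uv(2)] nxt_eq_iff uv(3) by metis
  then show "fst w - fst v \<notin> K \<and> fst (nxt D w) - fst v \<notin> K"
    using K uv(3) by (auto simp: direction_def blunt_cone_def)
qed

text \<open>
  If the two edges at a vertex are not collinear, one side of both is the convex sector between them;
  the other side is not convex, but it is covered by two overlapping half planes.
\<close>

lemma vertex_jumps: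
  assumes uv: "u \<in> verts D" "v \<in> verts D" "nxt D u = v"
  shows "\<exists>j. (\<forall>\<^sub>F s in at_right 0. across C u (1 - s) j) \<and> (\<forall>\<^sub>F s in at_right 0. across C v s j)"
proof -
  define p where "p = - direction D u"
  define q where "q = direction D v"
  define k where "k = wedge p q"
  have k': "wedge q p = - k"
    by (simp add: k_def wedge_commute[of q])
  have dirs: "direction D u = - p" "direction D v = q"
    by (simp_all add: p_def q_def)
  have nz: "p \<noteq> 0" "q \<noteq> 0"
    using direction_neq uv by (auto simp: p_def q_def)
  have z: "edge_point D u 1 = fst v" "edge_point D v 0 = fst v"
    using uv(3) by (simp_all add: edge_point_ends)
  note germ_ex = vertex_germ[OF uv, unfolded dirs minus_minus]
  have pos: "k * k > 0" if "k \<noteq> 0"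
    using that by (rule mult_self_pos)
  show ?thesis
  proof (cases "k = 0")
    case False
    let ?K1 = "sector p q" and ?H1 = "left_of (of_real (- k) * p)" and ?H2 = "left_of (of_real k * q)"
    have cones: "blunt_cone ?K1" "blunt_cone ?H1" "blunt_cone ?H2"
      using False nz by (auto intro!: blunt_cone_sector blunt_cone_left_of simp: k_def)
    have selfs: "p \<notin> ?K1" "q \<notin> ?K1" "p \<notin> ?H1" "q \<notin> ?H2"
      by (simp_all add: sector_def mem_left_of)
    have "q \<notin> ?H1" "p \<notin> ?H2"
      using pos[OF False] by (simp_all add: mem_left_of k' flip: k_def)
    with cones selfs obtain R1 R2 R2' where R: "germ D (fst v) ?K1 R1" "germ D (fst v) ?H1 R2"
      "germ D (fst v) ?H2 R2'"
      using germ_ex by meson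
    \<comment> \<open>A direction common to both half planes identifies their regions.\<close>
    have "- p - q \<in> ?H1" "- p - q \<in> ?H2"
      using pos[OF False] by (simp_all add: mem_left_of k' flip: k_def)
    then have "R2' = R2"
      using germ_unique[OF R(3,2)] cones by blast
    let ?U1 = "left_of (of_real (- k) * q)" and ?U2 = "left_of (of_real k * p)"
    have sec: "?K1 = ?U2 \<inter> ?U1"
      by (simp add: sector_def k_def)
    have "\<forall>\<^sub>F s in at_right 0. across C u (1 + - 1 * s) (C R1 + C R2)"
    proof (rule across_shift[OF uv(1)])
      show "- k \<noteq> 0" using False by simp
      show "germ D (edge_point D u 1) ?K1 R1" "germ D (edge_point D u 1) ?H1 R2"
        using R by (simp_all add: z)
      show "of_real (- 1) * direction D u \<in> ?U1"
        using pos[OF False] by (simp add: dirs mem_left_of k')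
    qed (use cones in \<open>auto simp: open_left_of dirs sec\<close>)
    moreover have "\<forall>\<^sub>F s in at_right 0. across C v (0 + 1 * s) (C R1 + C R2)"
    proof (rule across_shift[OF uv(2)])
      show "- k \<noteq> 0" using False by simp
      show "germ D (edge_point D v 0) ?K1 R1" "germ D (edge_point D v 0) ?H2 R2"
        using R by (simp_all add: z \<open>R2' = R2\<close>)
      show "of_real 1 * direction D v \<in> ?U2"
        using pos[OF False] by (simp add: dirs mem_left_of flip: k_def)
    qed (use cones in \<open>auto simp: open_left_of dirs sec\<close>)
    ultimately show ?thesis
      by auto
  next
    case True
    then obtain l where l: "q = of_real l * p"
      using wedge_eq_0[of p q] nz by (auto simp: k_def)
    then have "l \<noteq> 0"
      using nz by auto
    have pq: "p \<notin> left_of (of_real r * p)" "q \<notin> left_of (of_real r * p)" for r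
      using real_multiple_not_left_of[of 1 p r] real_multiple_not_left_of[of l p r] by (simp_all add: l)
    have cones: "blunt_cone (left_of p)" "blunt_cone (left_of (- p))"
      using nz by (simp_all add: blunt_cone_left_of)
    obtain R1 R2 where R: "germ D (fst v) (left_of p) R1" "germ D (fst v) (left_of (- p)) R2"
      using germ_ex[OF cones(1)] germ_ex[OF cones(2)] pq[of 1] pq[of "- 1"] by auto
    have "\<forall>\<^sub>F s in at_right 0. across C u (1 + - 1 * s) (C R1 + C R2)"
      using R cones by (intro across_shift[OF uv(1), of _ "- 1" _ "left_of p" _ "left_of (- p)" _ UNIV])
        (auto simp: z dirs)
    \<comment> \<open>The factor \<open>1 / l\<close> turns the direction of v back into p, whatever
      the sign of l.\<close>
    moreover have "\<forall>\<^sub>F s in at_right 0. across C v (0 + 1 * s) (C R1 + C R2)"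
      using R cones \<open>l \<noteq> 0\<close>
      by (intro across_shift[OF uv(2), of _ "1 / l" _ "left_of p" _ "left_of (- p)" _ UNIV])
        (auto simp: z dirs l)
    ultimately show ?thesis
      by auto
  qed
qed

end

lemma eventually_at_not_in_finite:
  fixes x :: "'a::t1_space"
  assumes "finite A"
  shows "\<forall>\<^sub>F t in at x within T. t \<notin> A"
proof -
  have "open (- (A - {x}))"
    using assms by (intro open_Compl finite_imp_closed) auto
  then show ?thesis
    unfolding eventually_at_topological by (intro exI[of _ "- (A - {x})"]) auto
qed

section \<open>One jump for every edge and every component\<close>

context diagram
begin

text \<open>By \<open>pedge_inter_unique\<close> every other edge blocks at most one
  parameter.\<close>

lemma finite_blocked:
  assumes v: "v \<in> verts D"
  shows "finite ({0<..<1} - free_params v)"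
proof -
  let ?B = "\<lambda>u. {t \<in> {0<..<1}. edge_point D v t \<in> pedge D u}"
  have "finite (?B u)" if u: "u \<in> verts D" "u \<noteq> v" for u
  proof (cases "?B u = {}")
    case False
    then obtain t0 where t0: "t0 \<in> ?B u"
      by blast
    have "t = t0" if t: "t \<in> ?B u" for t
    proof -
      have "edge_point D v t \<in> pedge D v" "edge_point D v t0 \<in> pedge D v"
        using t t0 by (auto intro!: edge_point_in)
      then have "edge_point D v t = edge_point D v t0"
        using pedge_inter_unique[OF u(1) v u(2)] t t0 by blast
      then show ?thesis
        using edge_point_inj[OF v] by simp
    qed
    then have "?B u \<subseteq> {t0}"
      by blast
    then show ?thesis
      by (rule finite_subset) simp
  qed (simp only: finite.emptyI)
  then have "finite (\<Union>u\<in>verts D - {v}. ?B u)"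
    using finite_verts by auto
  then show ?thesis
    by (rule rev_finite_subset) (auto simp: free_params_def)
qed

lemma eventually_free_params:
  assumes v: "v \<in> verts D"
  shows "t \<in> {0<..<1} \<Longrightarrow> \<forall>\<^sub>F s in at t. s \<in> free_params v"
    and "\<forall>\<^sub>F s in at_right 0. s \<in> free_params v"
    and "\<forall>\<^sub>F s in at_right 0. 1 - s \<in> free_params v"
proof -
  let ?A = "{0<..<1} - free_params v"
  have A: "finite ?A" "finite ((\<lambda>s. 1 - s) ` ?A)"
    using finite_blocked[OF v] by auto
  have I: "\<forall>\<^sub>F s::real in at_right 0. s \<in> {0<..<1}"
    by (rule eventually_at_right_real) simp
  show "\<forall>\<^sub>F s in at t. s \<in> free_params v" if "t \<in> {0<..<1}"
  proof -
    have "\<forall>\<^sub>F s in at t. s \<in> {0<..<1}"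
      using that by (intro eventually_at_in_open') auto
    then show ?thesis
      using eventually_at_not_in_finite[OF A(1)] by eventually_elim blast
  qed
  show "\<forall>\<^sub>F s in at_right 0. s \<in> free_params v"
    using I eventually_at_not_in_finite[OF A(1)] by eventually_elim blast
  show "\<forall>\<^sub>F s in at_right 0. 1 - s \<in> free_params v"
    using I eventually_at_not_in_finite[OF A(2)]
  proof eventually_elim
    case (elim s)
    then have "1 - s \<notin> ?A"
      by (metis (no_types, lifting) diff_diff_eq2 add_diff_cancel_left' imageI)
    then show ?case
      using elim(1) by auto
  qed
qed

definition has_jump :: "(complex set \<Rightarrow> bit) \<Rightarrow> point \<Rightarrow> bit \<Rightarrow> bool" where
  "has_jump C v b \<longleftrightarrow> (\<forall>t\<in>free_params v. across C v t b)"

lemma free_params_nonempty: "v \<in> verts D \<Longrightarrow> \<exists>t. t \<in> free_params v"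
  using eventually_happens'[OF trivial_limit_at_right_real eventually_free_params(2)] by blast

lemma has_jump_unique: "v \<in> verts D \<Longrightarrow> has_jump C v b \<Longrightarrow> has_jump C v b' \<Longrightarrow> b = b'"
  using free_params_nonempty across_unique unfolding has_jump_def by blast

text \<open>Reads the jump of an edge off any approach to one of its points or ends through free
  parameters.\<close>

lemma has_jump_eventually:
  assumes v: "v \<in> verts D" and j: "has_jump C v b" and F: "F \<noteq> bot"
    and ev: "\<forall>\<^sub>F s in F. across C v (f s) b'" "\<forall>\<^sub>F s in F. f s \<in> free_params v"
  shows "b = b'"
proof -
  have "\<exists>s. across C v (f s) b' \<and> f s \<in> free_params v"
    using eventually_happens'[OF F eventually_conj[OF ev]] .
  then show ?thesis
    using j across_unique[OF v] unfolding has_jump_def by blast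
qed

text \<open>An interior parameter is free or belongs to a crossing, and around either kind the
  difference across the edge is constant; the open interval is connected.\<close>

lemma has_jump_exists:
  assumes C: "C \<in> Col D" and v: "v \<in> verts D"
  shows "\<exists>b. has_jump C v b"
proof -
  have "\<exists>b. \<forall>t\<in>{0<..<1}. \<forall>\<^sub>F s in at t. across C v s b"
  proof (rule connected_eventually_const)
    fix t :: real assume t: "t \<in> {0<..<1}"
    show "\<exists>b. \<forall>\<^sub>F s in at t. across C v s b"
    proof (cases "t \<in> free_params v")
      case True
      then show ?thesis
        using across_exists[OF v] free_params_across[OF v] by blast
    next
      case False
      then obtain u where u: "u \<in> verts D" "u \<noteq> v" "edge_point D v t \<in> pedge D u"
        using t by (auto simp: free_params_def)
      have "edge_point D v t \<in> pedge D v"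
        using t by (intro edge_point_in) auto
      moreover have "edge_point D v t \<notin> fst ` verts D"
        using interior_not_vertex[OF v _ t] by blast
      ultimately have "(u, v) \<in> crossings D \<and> crossing_point D (u, v) = edge_point D v t \<or>
          (v, u) \<in> crossings D \<and> crossing_point D (v, u) = edge_point D v t"
        using double_point_crossing[OF u(1) v u(2,3)] by blast
      then show ?thesis
      proof (elim disjE conjE)
        assume c: "(u, v) \<in> crossings D" "crossing_point D (u, v) = edge_point D v t"
        obtain s where "crossing_point D (u, v) = edge_point D u s"
          using crossing_cases[OF c(1)] by metis
        then show ?thesis
          using crossing_jumps(2)[OF C c(1) _ c(2)] by (metis prod_cases3)
      next
        assume c: "(v, u) \<in> crossings D" "crossing_point D (v, u) = edge_point D v t"
        obtain s where "crossing_point D (v, u) = edge_point D u s"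
          using crossing_cases[OF c(1)] by metis
        then show ?thesis
          using crossing_jumps(1)[OF C c(1) c(2)] by (metis prod_cases3)
      qed
    qed
  next
    fix t :: real and b b'
    assume "\<forall>\<^sub>F s in at t. across C v s b" "\<forall>\<^sub>F s in at t. across C v s b'"
    then have "\<forall>\<^sub>F s in at t. b = b'"
      by eventually_elim (rule across_unique[OF v])
    then show "b = b'"
      by simp
  qed simp
  then obtain b where b: "\<And>t. t \<in> {0<..<1} \<Longrightarrow> \<forall>\<^sub>F s in at t. across C v s b"
    by blast
  \<comment> \<open>So far the value is known near t but not at t; a neighbouring parameter compares
    the two.\<close>
  have "across C v t b" if t: "t \<in> free_params v" for t
  proof -
    obtain b' where b': "across C v t b'"
      using across_exists[OF v t] by blast
    have t01: "t \<in> {0<..<1}"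
      using t by (simp add: free_params_def)
    have "\<forall>\<^sub>F s in at t. b = b'"
      using b[OF t01] free_params_across[OF v t b'] by eventually_elim (rule across_unique[OF v])
    then show ?thesis
      using b' by simp
  qed
  then show ?thesis
    unfolding has_jump_def by blast
qed

lemma has_jump_nxt:
  assumes u: "u \<in> verts D" and j: "has_jump C u b" "has_jump C (nxt D u) b'"
  shows "b = b'"
proof -
  have v: "nxt D u \<in> verts D"
    using u by (rule nxt_in)
  obtain j where "\<forall>\<^sub>F s in at_right 0. across C u (1 - s) j" "\<forall>\<^sub>F s in at_right 0. across C (nxt D u) s j"
    using vertex_jumps[OF u v refl] by blast
  then have "b = j" "b' = j"
    using has_jump_eventually[OF u j(1) trivial_limit_at_right_real _ eventually_free_params(3)[OF u]]
      has_jump_eventually[OF v j(2) trivial_limit_at_right_real _ eventually_free_params(2)[OF v]]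
    by blast+
  then show ?thesis
    by simp
qed

lemma has_jump_crossing:
  assumes C: "C \<in> Col D" and c: "(a, b) \<in> crossings D"
    and xyz: "color_triple D C (a, b) = (x, y, z)"
  shows "has_jump C a (x + z)" "has_jump C b (x + y)"
proof -
  obtain s t where st: "a \<in> verts D" "b \<in> verts D" "s \<in> {0<..<1}" "t \<in> {0<..<1}"
    "crossing_point D (a, b) = edge_point D a s" "crossing_point D (a, b) = edge_point D b t"
    using crossing_cases[OF c] by metis
  obtain j k where jk: "has_jump C a j" "has_jump C b k"
    using has_jump_exists[OF C] st by metis
  have "j = x + z" "k = x + y"
    using has_jump_eventually[OF st(1) jk(1) at_neq_bot crossing_jumps(1)[OF C c st(5,6) xyz]
        eventually_free_params(1)[OF st(1,3)]]
      has_jump_eventually[OF st(2) jk(2) at_neq_bot crossing_jumps(2)[OF C c st(5,6) xyz]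
        eventually_free_params(1)[OF st(2,4)]] by blast+
  then show "has_jump C a (x + z)" "has_jump C b (x + y)"
    using jk by auto
qed

definition jump_set :: "(complex set \<Rightarrow> bit) \<Rightarrow> point set" where
  "jump_set C = {v \<in> verts D. has_jump C v 1}"

text \<open>Jumps persist through vertices, so \<open>nxt D\<close> maps the set into itself; being
  injective on a finite set, it maps it onto itself.\<close>

lemma sublink_jump_set:
  assumes "C \<in> Col D"
  shows "sublink D (jump_set C)"
proof -
  have "nxt D ` jump_set C \<subseteq> jump_set C"
    using has_jump_nxt has_jump_exists[OF assms] nxt_in unfolding jump_set_def by blast
  moreover have "finite (jump_set C)" "inj_on (nxt D) (jump_set C)"
    using finite_verts by (auto simp: jump_set_def inj_on_def nxt_eq_iff)
  ultimately have "nxt D ` jump_set C = jump_set C"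
    by (intro endo_inj_surj)
  then show ?thesis
    by (auto simp: sublink_def jump_set_def)
qed

text \<open>The over-edge jumps by x + z and the under-edge by x + y; exactly these two triples make
  them 1 and 0.\<close>

lemma color_triple_jump_set:
  assumes C: "C \<in> Col D" and c: "c \<in> crossings D"
  shows "color_triple D C c \<in> {(0, 0, 1), (1, 1, 0)} \<longleftrightarrow>
    fst c \<in> jump_set C \<and> snd c \<in> verts D - jump_set C"
proof -
  obtain a b where ab: "c = (a, b)" "a \<in> verts D" "b \<in> verts D"
    using c by (auto simp: crossings_def)
  obtain x y z where xyz: "color_triple D C (a, b) = (x, y, z)"
    by (metis prod_cases3)
  have "has_jump C a 1 \<longleftrightarrow> x + z = 1" "has_jump C b 1 \<longleftrightarrow> x + y = 1"
    using has_jump_crossing[OF C c[unfolded ab(1)] xyz] has_jump_unique ab(2,3) by metis+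
  then show ?thesis
    using ab xyz by (cases x; cases y; cases z) (auto simp: jump_set_def)
qed

section \<open>Colorings with the same jumps\<close>

lemma plane_curve_interior: "interior (plane_curve D) = {}"
proof -
  have "negligible (plane_curve D)"
    unfolding plane_curve_eq pedge_def
    using finite_verts by (intro negligible_Union) (auto simp: negligible_convex_interior interior_closed_segment_ge2)
  then show ?thesis
    using open_not_negligible[OF open_interior] negligible_subset interior_subset by metis
qed

lemma closed_plane_curve: "closed (plane_curve D)"
  unfolding plane_curve_eq pedge_def using finite_verts by (intro closed_UN) auto

lemma regions_disjoint: "R \<in> regions D \<Longrightarrow> R' \<in> regions D \<Longrightarrow> z \<in> R \<Longrightarrow> z \<in> R' \<Longrightarrow> R = R'"
  unfolding regions_def by (metis components_eq disjoint_iff)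

lemma open_region: "R \<in> regions D \<Longrightarrow> open R"
  unfolding regions_def using closed_plane_curve by (auto intro: open_components)

lemma region_avoids: "R \<in> regions D \<Longrightarrow> R \<subseteq> - plane_curve D"
  unfolding regions_def by (rule in_components_subset)

lemma region_ex: "z \<notin> plane_curve D \<Longrightarrow> \<exists>R\<in>regions D. z \<in> R"
  unfolding regions_def using Union_components[of "- plane_curve D"] by blast

lemma wedge_trichotomy:
  assumes "d \<noteq> 0"
  obtains "x \<in> left_of d" | "x \<in> left_of (- d)" | k where "x = of_real k * d"
  using assms wedge_eq_0[of d x] by (cases "wedge d x" "0::real" rule: linorder_cases) (auto simp: mem_left_of)

text \<open>Both colorings change equally across every edge, so their sum continues over the open
  edges. Only vertices and crossings need to be removed, and the plane without finitely many points
  is connected.\<close>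

lemma same_jumps:
  assumes C: "C \<in> Col D" and C': "C' \<in> Col D" and same: "jump_set C = jump_set C'"
  shows "\<exists>b. \<forall>R\<in>regions D. C R + C' R = b"
proof -
  define F where "F = fst ` verts D \<union> crossing_point D ` crossings D"
  \<comment> \<open>\<open>P\<close> is vacuous on the diagram, so neighbourhoods may meet it; the
    value stays unique because the diagram has empty interior.\<close>
  define P where "P z b \<longleftrightarrow> (\<forall>R\<in>regions D. z \<in> R \<longrightarrow> C R + C' R = b)" for z b
  have "finite F"
    using finite_verts finite_crossings by (simp add: F_def)
  have F_sub: "F \<subseteq> plane_curve D"
  proof -
    have "fst v \<in> pedge D v" for v
      by (simp add: pedge_def)
    then have "fst ` verts D \<subseteq> plane_curve D"
      unfolding plane_curve_eq by blast
    moreover have "crossing_point D c \<in> plane_curve D" if c: "c \<in> crossings D" for c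
    proof -
      obtain a b where ab: "c = (a, b)"
        by (cases c)
      obtain s where "a \<in> verts D" "s \<in> {0<..<1}" "crossing_point D c = edge_point D a s"
        using crossing_cases[OF c[unfolded ab]] unfolding ab by metis
      then show ?thesis
        using edge_point_in[of s D a] unfolding plane_curve_eq by auto
    qed
    ultimately show ?thesis
      unfolding F_def by blast
  qed
  have "\<exists>b. \<forall>z\<in>- F. \<forall>\<^sub>F x in at z. P x b"
  proof (rule connected_eventually_const)
    show "connected (- F)"
      using \<open>finite F\<close> by (intro path_connected_imp_connected path_connected_complement_countable)
        (auto intro: countable_finite)
  next
    fix z b b' assume ev: "\<forall>\<^sub>F x in at z. P x b" "\<forall>\<^sub>F x in at z. P x b'"
    obtain S where S: "open S" "z \<in> S" "\<And>x. x \<in> S \<Longrightarrow> x \<noteq> z \<Longrightarrow> P x b \<and> P x b'"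
      using eventually_conj[OF ev] by (auto simp: eventually_at_topological)
    show "b = b'"
    proof (rule ccontr)
      assume neq: "b \<noteq> b'"
      have "S - {z} \<subseteq> plane_curve D"
      proof (rule subsetI, rule ccontr)
        fix x assume x: "x \<in> S - {z}" "x \<notin> plane_curve D"
        then obtain R where R: "R \<in> regions D" "x \<in> R"
          using region_ex by blast
        have "P x b" "P x b'"
          using S(3)[of x] x(1) by auto
        then have "C R + C' R = b" "C R + C' R = b'"
          using R unfolding P_def by blast+
        then show False
          using neq by metis
      qed
      then have "S - {z} = {}"
        using plane_curve_interior S(1) by (metis interior_maximal open_delete subset_empty)
      then have "S = {z}"
        using S(2) by blast
      then show False
        using S(1) not_open_singleton by blast
    qed
  next
    fix z assume z: "z \<in> - F"
    show "\<exists>b. \<forall>\<^sub>F x in at z. P x b"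
    proof (cases "z \<in> plane_curve D")
      case False
      then obtain R where R: "R \<in> regions D" "z \<in> R"
        using region_ex by blast
      have "P x (C R + C' R)" if "x \<in> R" for x
        unfolding P_def using that R(1) regions_disjoint by metis
      moreover have "\<forall>\<^sub>F x in at z. x \<in> R"
        using R open_region by (intro eventually_at_in_open') auto
      ultimately show ?thesis
        by (meson eventually_mono)
    next
      case True
      then obtain v where v: "v \<in> verts D" "z \<in> pedge D v"
        by (auto simp: plane_curve_eq)
      have nv: "z \<notin> fst ` verts D"
        using z by (simp add: F_def)
      obtain t where t: "t \<in> {0<..<1}" "z = edge_point D v t"
        using nonvertex_interior[OF v nv] by blast
      have "u = v" if "u \<in> verts D" "z \<in> pedge D u" for u
        using double_point_crossing[OF that(1) v(1) _ that(2) v(2) nv] z unfolding F_def by blast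
      then have free: "t \<in> free_params v"
        using t by (auto simp: free_params_def)
      obtain j where j: "has_jump C v j" "has_jump C' v j"
      proof -
        obtain i k where ik: "has_jump C v i" "has_jump C' v k"
          using has_jump_exists[OF C v(1)] has_jump_exists[OF C' v(1)] by blast
        moreover have "i = 1 \<longleftrightarrow> k = 1"
          using same v(1) ik has_jump_unique[OF v(1)] unfolding jump_set_def by blast
        ultimately show ?thesis
          using that by (cases i; cases k) auto
      qed
      let ?d = "direction D v"
      obtain R R' where R: "germ D z (left_of ?d) R" "germ D z (left_of (- ?d)) R'"
        using across_exists[OF v(1) free] unfolding across_def t(2) by blast
      have "C R + C R' = j" "C' R + C' R' = j"
        using j free across_unique[OF v(1)] acrossI R unfolding has_jump_def t(2) by blast+
      then have eq: "C R + C' R = C R' + C' R'"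
        by (cases "C R"; cases "C R'"; cases "C' R"; cases "C' R'") auto
      obtain e e' where e: "e > 0" "e' > 0" "\<And>x. x \<in> left_of ?d \<Longrightarrow> norm x < e \<Longrightarrow> z + x \<in> R"
        "\<And>x. x \<in> left_of (- ?d) \<Longrightarrow> norm x < e' \<Longrightarrow> z + x \<in> R'"
        using R unfolding germ_def by blast
      \<comment> \<open>The last bound keeps points on the line of the edge within the edge, where
        \<open>P\<close> is vacuous.\<close>
      define h where "h = min (min e e') (min t (1 - t) * norm ?d)"
      have d: "?d \<noteq> 0"
        using direction_neq[OF v(1)] .
      have "h > 0"
        using e(1,2) t(1) d by (auto simp: h_def)
      have "P x (C R + C' R)" if x: "x \<in> ball z h" for x
      proof -
        have nx: "norm (x - z) < h"
          using x by (simp add: dist_norm norm_minus_commute)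
        show ?thesis
        proof (rule wedge_trichotomy[OF d, of "x - z"])
          assume "x - z \<in> left_of ?d"
          then have "x \<in> R"
            using e(3)[of "x - z"] nx by (simp add: h_def)
          then show ?thesis
            unfolding P_def using R(1) regions_disjoint unfolding germ_def by metis
        next
          assume "x - z \<in> left_of (- ?d)"
          then have "x \<in> R'"
            using e(4)[of "x - z"] nx by (simp add: h_def)
          then show ?thesis
            unfolding P_def eq using R(2) regions_disjoint unfolding germ_def by metis
        next
          fix k assume k: "x - z = of_real k * ?d"
          then have "\<bar>k\<bar> * norm ?d < min t (1 - t) * norm ?d"
            using nx by (simp add: h_def norm_mult)
          then have "\<bar>k\<bar> < min t (1 - t)"
            using d by (simp add: mult_less_cancel_right)
          then have "t + k \<in> {0..1}"
            by auto
          moreover have "x = edge_point D v (t + k)"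
            using k unfolding t(2) edge_point_shift by (simp add: algebra_simps)
          ultimately have "x \<in> plane_curve D"
            using v(1) edge_point_in unfolding plane_curve_eq by blast
          then show ?thesis
            unfolding P_def using region_avoids by blast
        qed
      qed
      then have "\<forall>\<^sub>F x in at z. P x (C R + C' R)"
        using \<open>h > 0\<close> unfolding eventually_at by (auto simp: dist_commute)
      then show ?thesis
        by blast
    qed
  qed
  then obtain b where b: "\<And>z. z \<in> - F \<Longrightarrow> \<forall>\<^sub>F x in at z. P x b"
    by blast
  have "C R + C' R = b" if R: "R \<in> regions D" for R
  proof -
    obtain z where z: "z \<in> R"
      using R unfolding regions_def by (metis equals0I in_components_nonempty)
    then have "z \<in> - F"
      using region_avoids[OF R] F_sub by blast
    then have "\<forall>\<^sub>F x in at z. P x b \<and> x \<in> R"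
      using b z open_region[OF R] by (intro eventually_conj eventually_at_in_open') auto
    then obtain x where "P x b" "x \<in> R"
      using eventually_happens'[OF at_neq_bot] by blast
    then show ?thesis
      using R unfolding P_def by blast
  qed
  then show ?thesis
    by blast
qed

end

section \<open>The coloring of a sublink\<close>

text \<open>The signed angle under which the projected edge is seen from z; the branch cut of
  \<open>Ln\<close> is met only when z lies on the edge.\<close>

definition angle :: "link \<Rightarrow> point \<Rightarrow> complex \<Rightarrow> real" where
  "angle D v z = Im (Ln ((fst (nxt D v) - z) / (fst v - z)))"

definition wind :: "link \<Rightarrow> point set \<Rightarrow> complex \<Rightarrow> real" where
  "wind D S z = (\<Sum>v\<in>S. angle D v z) / (2 * pi)"

lemma nonpos_ratio_in_segment:
  fixes a b z :: complex
  assumes "z \<noteq> a" "(b - z) / (a - z) \<in> \<real>\<^sub>\<le>\<^sub>0"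
  shows "z \<in> closed_segment a b"
proof -
  obtain r where r: "r \<le> 0" "(b - z) / (a - z) = of_real r"
    using assms(2) by (auto simp: nonpos_Reals_def)
  then have "b - z = of_real r * (a - z)"
    using assms(1) by (simp add: field_simps)
  then have z: "of_real (1 - r) * z = b - of_real r * a"
    by (simp add: algebra_simps)
  let ?u = "1 / (1 - r)"
  have "of_real ?u * (of_real (1 - r) * z) = z"
    using r(1) by (simp add: mult.assoc[symmetric] flip: of_real_mult)
  then have "z = of_real ?u * b - of_real (?u * r) * a"
    by (simp only: z right_diff_distrib of_real_mult mult.assoc)
  moreover have "1 - ?u = - (?u * r)"
    using r(1) by (simp add: field_simps)
  ultimately have "z = (1 - ?u) *\<^sub>R a + ?u *\<^sub>R b"
    by (simp add: scaleR_conv_of_real del: of_real_mult)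
  then show ?thesis
    using r(1) unfolding in_segment by (intro exI[of _ ?u]) auto
qed

lemma continuous_angle:
  assumes "z \<notin> pedge D v"
  shows "isCont (angle D v) z"
proof -
  have a: "fst v - z \<noteq> 0"
    using assms by (auto simp: pedge_def)
  then have "(fst (nxt D v) - z) / (fst v - z) \<notin> \<real>\<^sub>\<le>\<^sub>0"
    using nonpos_ratio_in_segment[of z "fst v"] assms by (auto simp: pedge_def)
  with a show ?thesis
    unfolding angle_def by (intro isCont_Im isCont_Ln' continuous_intros)
qed

lemma continuous_on_Ints_eq:
  fixes f :: "'a::topological_space \<Rightarrow> real"
  assumes "connected R" "continuous_on R f" "\<And>z. z \<in> R \<Longrightarrow> f z \<in> \<int>" "x \<in> R" "y \<in> R"
  shows "f x = f y"
proof -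
  have "f constant_on R"
  proof (rule continuous_discrete_range_constant[OF assms(1,2)])
    fix x assume x: "x \<in> R"
    have "1 \<le> norm (f y - f x)" if "y \<in> R" "f y \<noteq> f x" for y
      using Ints_nonzero_abs_ge1[of "f y - f x"] assms(3) x that by auto
    then show "\<exists>e>0. \<forall>y. y \<in> R \<and> f y \<noteq> f x \<longrightarrow> e \<le> norm (f y - f x)"
      by (intro exI[of _ 1]) auto
  qed
  then show ?thesis
    using assms(4,5) by (auto simp: constant_on_def)
qed

text \<open>At the limit r of \<open>- f\<close> the logarithm is continuous, and the sign of
  \<open>Im (f t)\<close> decides that returning to \<open>f\<close> adds pi.\<close>

lemma Im_Ln_tendsto_pi:
  assumes f: "(f \<longlongrightarrow> of_real (- r)) F" and r: "r > 0" and pos: "\<forall>\<^sub>F t in F. Im (f t) > 0"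
  shows "((\<lambda>t. Im (Ln (f t))) \<longlongrightarrow> pi) F"
proof -
  have "((\<lambda>t. - f t) \<longlongrightarrow> of_real r) F"
    using tendsto_minus[OF f] by simp
  then have "((\<lambda>t. Ln (- f t)) \<longlongrightarrow> Ln (of_real r)) F"
    using r by (intro tendsto_Ln) (auto simp: complex_nonpos_Reals_iff)
  then have "((\<lambda>t. Im (Ln (- f t)) + pi) \<longlongrightarrow> Im (Ln (of_real r)) + pi) F"
    by (intro tendsto_add tendsto_Im tendsto_const)
  moreover have "\<forall>\<^sub>F t in F. Im (Ln (- f t)) + pi = Im (Ln (f t))"
    using pos
  proof eventually_elim
    case (elim t)
    then have "- f t \<noteq> 0"
      by auto
    then show ?case
      using elim Ln_minus[of "- f t"] by auto
  qed
  ultimately have "((\<lambda>t. Im (Ln (f t))) \<longlongrightarrow> Im (Ln (of_real r)) + pi) F"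
    by (rule Lim_transform_eventually)
  then show ?thesis
    using r by (simp add: Ln_of_real)
qed

text \<open>Complex conjugation reduces this to the approach from above.\<close>

lemma Im_Ln_tendsto_minus_pi:
  assumes f: "(f \<longlongrightarrow> of_real (- r)) F" and r: "r > 0" and neg: "\<forall>\<^sub>F t in F. Im (f t) < 0"
  shows "((\<lambda>t. Im (Ln (f t))) \<longlongrightarrow> - pi) F"
proof -
  have "((\<lambda>t. cnj (f t)) \<longlongrightarrow> cnj (of_real (- r))) F"
    by (intro tendsto_intros f)
  then have "((\<lambda>t. Im (Ln (cnj (f t)))) \<longlongrightarrow> pi) F"
    using neg r by (intro Im_Ln_tendsto_pi[of _ r]) auto
  then have "((\<lambda>t. - Im (Ln (cnj (f t)))) \<longlongrightarrow> - pi) F"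
    by (rule tendsto_minus)
  moreover have "\<forall>\<^sub>F t in F. - Im (Ln (cnj (f t))) = Im (Ln (f t))"
    using neg
  proof eventually_elim
    case (elim t)
    then have "f t \<notin> \<real>\<^sub>\<le>\<^sub>0"
      by (auto simp: complex_nonpos_Reals_iff)
    then have "cnj (Ln (f t)) = Ln (cnj (f t))"
      by (rule cnj_Ln)
    then show ?case
      by (metis complex_cnj_complex_of_real minus_minus cnj.simps(2))
  qed
  ultimately show ?thesis
    by (rule Lim_transform_eventually)
qed

text \<open>From a point close to the interior of the edge, its ends appear in almost opposite
  directions: the quotient tends to a negative number, from above or below according to the side to
  which n points.\<close>

lemma angle_at_edge:
  assumes d: "direction D v \<noteq> 0" and s: "s \<in> {0<..<1}" and n: "wedge (direction D v) n \<noteq> 0"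
  shows "((\<lambda>t. angle D v (edge_point D v s + of_real t * n)) \<longlongrightarrow> pi * sgn (wedge (direction D v) n)) (at_right 0)"
proof -
  let ?d = "direction D v"
  define f where "f t = (of_real (1 - s) * ?d - of_real t * n) / (of_real (- s) * ?d - of_real t * n)" for t
  have angle: "angle D v (edge_point D v s + of_real t * n) = Im (Ln (f t))" for t
    by (simp add: angle_def f_def edge_point_def direction_def algebra_simps)
  have "(f \<longlongrightarrow> (of_real (1 - s) * ?d - of_real 0 * n) / (of_real (- s) * ?d - of_real 0 * n)) (at_right 0)"
    unfolding f_def using d s by (intro tendsto_intros) auto
  moreover have "(of_real (1 - s) * ?d - of_real 0 * n) / (of_real (- s) * ?d - of_real 0 * n) =
      of_real (- ((1 - s) / s))"
    using d s by (simp add: field_simps)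
  ultimately have lim: "(f \<longlongrightarrow> of_real (- ((1 - s) / s))) (at_right 0)"
    by simp
  have r: "(1 - s) / s > 0"
    using s by simp
  have sgn: "sgn (Im (f t)) = sgn (wedge ?d n)" if t: "t > 0" for t
  proof -
    let ?y = "of_real (- s) * ?d - of_real t * n"
    have "wedge ?d ?y = - (t * wedge ?d n)"
      by simp
    then have "wedge ?d ?y \<noteq> 0"
      using n t by simp
    then have "?y \<noteq> 0"
      by (metis wedge_simps(3))
    then have "(norm ?y)\<^sup>2 > 0"
      by simp
    \<comment> \<open>With the denominator made real, the sign of \<open>Im (f t)\<close> is that of
      a determinant, of which only the mixed terms in the direction and n survive.\<close>
    have "f t = (of_real (1 - s) * ?d - of_real t * n) * cnj ?y / of_real ((norm ?y)\<^sup>2)"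
      unfolding f_def by (rule complex_div_cnj)
    then have "Im (f t) = wedge ?y (of_real (1 - s) * ?d - of_real t * n) / (norm ?y)\<^sup>2"
      by (simp only: Im_divide_of_real wedge_def mult.commute)
    also have "wedge ?y (of_real (1 - s) * ?d - of_real t * n) = t * wedge ?d n"
      unfolding wedge_simps wedge_commute[of n ?d] by (simp add: algebra_simps)
    finally show ?thesis
      using t \<open>(norm ?y)\<^sup>2 > 0\<close> by (simp add: sgn_mult sgn_divide)
  qed
  have ev: "\<forall>\<^sub>F t in at_right 0. sgn (Im (f t)) = sgn (wedge ?d n)"
    using sgn by (auto intro: eventually_mono[OF eventually_at_right_less])
  show ?thesis
  proof (cases "wedge ?d n > 0")
    case True
    then have "\<forall>\<^sub>F t in at_right 0. Im (f t) > 0"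
      using ev by (auto elim!: eventually_mono simp: sgn_if split: if_splits)
    then show ?thesis
      using Im_Ln_tendsto_pi[OF lim r] True by (simp add: angle)
  next
    case False
    then have "\<forall>\<^sub>F t in at_right 0. Im (f t) < 0"
      using ev n by (auto elim!: eventually_mono simp: sgn_if split: if_splits)
    then show ?thesis
      using Im_Ln_tendsto_minus_pi[OF lim r] False n by (simp add: angle)
  qed
qed

section \<open>The parity of the winding number as a coloring\<close>

context diagram
begin

text \<open>
  The limit of \<open>angle D v\<close> along the ray from \<open>z\<close> in direction \<open>n\<close>: at an interior point of the
  edge, the branch cut of \<open>Ln\<close> makes it jump by \<open>2 * pi\<close>.
\<close>

definition side_angle :: "complex \<Rightarrow> complex \<Rightarrow> point \<Rightarrow> real" where
  "side_angle z n v = (if z \<in> pedge D v then pi * sgn (wedge (direction D v) n) else angle D v z)"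

text \<open>Any point of R will do, because the winding number of a sublink is constant on regions;
  it is an integer there, so the floor only changes the type.\<close>

definition coloring :: "point set \<Rightarrow> bit \<Rightarrow> complex set \<Rightarrow> bit" where
  "coloring S b = (\<lambda>R\<in>regions D. of_int \<lfloor>wind D S (SOME z. z \<in> R)\<rfloor> + b)"

lemma angle_tendsto:
  assumes v: "v \<in> verts D" and z: "z \<notin> fst ` verts D"
    and n: "z \<in> pedge D v \<Longrightarrow> wedge (direction D v) n \<noteq> 0"
  shows "((\<lambda>t. angle D v (z + of_real t * n)) \<longlongrightarrow> side_angle z n v) (at_right 0)"
proof (cases "z \<in> pedge D v")
  case True
  obtain s where "s \<in> {0<..<1}" "z = edge_point D v s"
    using nonvertex_interior[OF v True z] by blast
  then show ?thesis
    using angle_at_edge[OF direction_neq[OF v] _ n[OF True]] True by (simp add: side_angle_def)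
next
  case False
  have "((\<lambda>t. z + of_real t * n) \<longlongrightarrow> z + of_real 0 * n) (at_right 0)"
    by (intro tendsto_intros)
  then have "((\<lambda>t. angle D v (z + of_real t * n)) \<longlongrightarrow> angle D v z) (at_right 0)"
    using isCont_tendsto_compose[OF continuous_angle[OF False]] by simp
  then show ?thesis
    using False by (simp add: side_angle_def)
qed

text \<open>The quotients whose logarithms are summed have product 1 because \<open>nxt D\<close> permutes \<open>S\<close>.\<close>

lemma wind_Ints:
  assumes S: "sublink D S" and z: "z \<notin> plane_curve D"
  shows "wind D S z \<in> \<int>"
proof -
  have sub: "S \<subseteq> verts D" "nxt D ` S = S"
    using S by (auto simp: sublink_def)
  have fin: "finite S"
    using sub finite_verts finite_subset by blast
  have nz: "fst v - z \<noteq> 0" if "v \<in> verts D" for v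
    using z that ends_in_segment(1)[of "fst v"] by (auto simp: plane_curve_eq pedge_def)
  have "exp (\<Sum>v\<in>S. Ln ((fst (nxt D v) - z) / (fst v - z))) =
      (\<Prod>v\<in>S. (fst (nxt D v) - z) / (fst v - z))"
  proof -
    have "(fst (nxt D v) - z) / (fst v - z) \<noteq> 0" if "v \<in> S" for v
      using that sub(1) nz nz[OF nxt_in] by (metis divide_eq_0_iff subset_iff)
    then show ?thesis
      by (simp add: exp_sum[OF fin] exp_Ln cong: prod.cong)
  qed
  also have "\<dots> = (\<Prod>v\<in>S. fst (nxt D v) - z) / (\<Prod>v\<in>S. fst v - z)"
    by (rule prod_dividef)
  also have "(\<Prod>v\<in>S. fst (nxt D v) - z) = (\<Prod>v\<in>nxt D ` S. fst v - z)"
    by (subst prod.reindex) (auto simp: inj_on_def nxt_eq_iff)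
  also have "\<dots> / (\<Prod>v\<in>S. fst v - z) = 1"
  proof -
    have "(\<Prod>v\<in>S. fst v - z) \<noteq> 0"
      unfolding prod_zero_iff[OF fin] using sub(1) nz by blast
    then show ?thesis
      by (simp add: sub(2))
  qed
  finally obtain m :: int where
    "Im (\<Sum>v\<in>S. Ln ((fst (nxt D v) - z) / (fst v - z))) = of_int (2 * m) * pi"
    by (auto simp: exp_eq_1)
  then have "wind D S z = of_int m"
    by (simp add: wind_def angle_def)
  then show ?thesis
    by simp
qed

text \<open>A region avoids all edges, so the angles are continuous on it, and a continuous
  integer-valued function on a connected set is constant.\<close>

lemma wind_region:
  assumes S: "sublink D S" and R: "R \<in> regions D" "z \<in> R" "w \<in> R"
  shows "wind D S z = wind D S w"
proof (rule continuous_on_Ints_eq[where f = "wind D S" and R = R])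
  have "continuous_on R (angle D v)" if "v \<in> S" for v
  proof -
    have "x \<notin> pedge D v" if "x \<in> R" for x
      using region_avoids[OF R(1)] that \<open>v \<in> S\<close> S unfolding plane_curve_eq sublink_def by blast
    then show ?thesis
      by (intro continuous_at_imp_continuous_on ballI continuous_angle)
  qed
  then show "continuous_on R (wind D S)"
    unfolding wind_def[abs_def] by (intro continuous_intros) auto
  show "connected R"
    using R(1) in_components_connected unfolding regions_def by blast
  show "\<And>x. x \<in> R \<Longrightarrow> wind D S x \<in> \<int>"
    using wind_Ints[OF S] region_avoids[OF R(1)] by blast
qed (use R in auto)

lemma coloring_eq:
  assumes S: "sublink D S" and R: "R \<in> regions D" "z \<in> R" "wind D S z = of_int m"
  shows "coloring S b R = of_int m + b"
proof -
  have "wind D S (SOME z. z \<in> R) = of_int m"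
    using wind_region[OF S R(1,2) someI[of "\<lambda>z. z \<in> R", OF R(2)]] R(3) by simp
  then show ?thesis
    using R(1) by (simp only: coloring_def restrict_apply' floor_of_int)
qed

text \<open>Within R the sum of the angles is constantly \<open>2 * pi * of_int m\<close>, so its
  limit at z along n has the same value. This makes the regions around one point comparable through
  \<open>side_angle\<close> alone.\<close>

lemma germ_coloring:
  assumes S: "sublink D S" and g: "germ D z K R" "n \<in> K" "blunt_cone K"
    and z: "z \<notin> fst ` verts D"
    and n: "\<And>v. v \<in> verts D \<Longrightarrow> z \<in> pedge D v \<Longrightarrow> wedge (direction D v) n \<noteq> 0"
  shows "\<exists>m. (\<Sum>v\<in>S. side_angle z n v) = 2 * pi * of_int m \<and> (\<forall>b. coloring S b R = of_int m + b)"
proof -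
  have R: "R \<in> regions D"
    using g(1) by (simp add: germ_def)
  obtain e where e: "e > 0" "\<And>x. x \<in> K \<Longrightarrow> norm x < e \<Longrightarrow> z + x \<in> R"
    using g(1) by (auto simp: germ_def)
  have n0: "norm n > 0"
    using g(2,3) by (auto simp: blunt_cone_def)
  have "z + of_real t * n \<in> R" if "t \<in> {0<..<e / norm n}" for t
    using that g(2,3) n0 by (intro e) (auto simp: blunt_cone_def norm_mult pos_less_divide_eq)
  moreover have "\<forall>\<^sub>F t in at_right 0. t \<in> {0<..<e / norm n}"
    using e n0 by (intro eventually_at_right_real) auto
  ultimately have ev: "\<forall>\<^sub>F t in at_right 0. z + of_real t * n \<in> R"
    by (auto elim!: eventually_mono)
  then obtain t0 where t0: "z + of_real t0 * n \<in> R"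
    using eventually_happens'[OF trivial_limit_at_right_real] by blast
  then have "wind D S (z + of_real t0 * n) \<in> \<int>"
    using wind_Ints[OF S] region_avoids[OF R] by blast
  then obtain m where m: "wind D S (z + of_real t0 * n) = of_int m"
    by (auto elim: Ints_cases)
  have col: "coloring S b R = of_int m + b" for b
    using coloring_eq[OF S R t0 m] .
  have const: "wind D S w = of_int m" if w: "w \<in> R" for w
    using wind_region[OF S R w t0] m by simp
  have "((\<lambda>t. \<Sum>v\<in>S. angle D v (z + of_real t * n)) \<longlongrightarrow> (\<Sum>v\<in>S. side_angle z n v)) (at_right 0)"
    using S z n by (intro tendsto_sum angle_tendsto) (auto simp: sublink_def)
  moreover have "\<forall>\<^sub>F t in at_right 0. (\<Sum>v\<in>S. angle D v (z + of_real t * n)) = 2 * pi * of_int m"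
    using ev
  proof eventually_elim
    case (elim t)
    then show ?case
      using const[OF elim] by (simp add: wind_def field_simps)
  qed
  ultimately have "((\<lambda>t. 2 * pi * of_int m) \<longlongrightarrow> (\<Sum>v\<in>S. side_angle z n v)) (at_right (0::real))"
    by (rule Lim_transform_eventually)
  then have "(\<Sum>v\<in>S. side_angle z n v) = 2 * pi * of_int m"
    by (simp add: tendsto_const_iff)
  then show ?thesis
    using col by blast
qed

text \<open>Edges that avoid z have the same limit angle in every direction and cancel.\<close>

lemma sum_side_angle_diff:
  assumes "finite S"
  shows "(\<Sum>v\<in>S. side_angle z n v) - (\<Sum>v\<in>S. side_angle z n' v) =
    (\<Sum>v\<in>{v\<in>S. z \<in> pedge D v}. pi * (sgn (wedge (direction D v) n) - sgn (wedge (direction D v) n')))"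
proof -
  have "(\<Sum>v\<in>S. side_angle z n v) - (\<Sum>v\<in>S. side_angle z n' v) =
      (\<Sum>v\<in>S. if z \<in> pedge D v then pi * (sgn (wedge (direction D v) n) - sgn (wedge (direction D v) n')) else 0)"
    unfolding sum_subtractf[symmetric]
    by (intro sum.cong) (auto simp: side_angle_def algebra_simps)
  then show ?thesis
    using assms by (simp add: sum.inter_filter)
qed

lemma finite_sublink: "sublink D S \<Longrightarrow> finite S"
  using finite_verts finite_subset by (auto simp: sublink_def)

text \<open>Only v passes through the point, and its side angles pi and - pi differ by a full turn,
  so the winding number changes by 1 if v belongs to S and not at all otherwise.\<close>

lemma has_jump_coloring:
  assumes S: "sublink D S" and v: "v \<in> verts D"
  shows "has_jump (coloring S b) v (of_bool (v \<in> S))"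
  unfolding has_jump_def
proof
  fix t assume t: "t \<in> free_params v"
  let ?d = "direction D v" and ?z = "edge_point D v t"
  have t01: "t \<in> {0<..<1}"
    using t by (simp add: free_params_def)
  have nv: "?z \<notin> fst ` verts D"
    using interior_not_vertex[OF v _ t01] by blast
  have only: "u = v" if "u \<in> verts D" "?z \<in> pedge D u" for u
    using t that by (auto simp: free_params_def)
  have on: "?z \<in> pedge D v"
    using t01 by (intro edge_point_in) auto
  obtain R R' where R: "germ D ?z (left_of ?d) R" "germ D ?z (left_of (- ?d)) R'"
    using across_exists[OF v t] unfolding across_def by blast
  note cone = left_of_direction[OF v]
  let ?n = "\<i> * ?d"
  have pos: "wedge ?d ?n > 0"
    using cone(3) by (simp add: mem_left_of)
  obtain m where m: "(\<Sum>v\<in>S. side_angle ?z ?n v) = 2 * pi * of_int m" "coloring S b R = of_int m + b"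
    using germ_coloring[OF S R(1) cone(3,1) nv] only pos by fastforce
  obtain m' where m': "(\<Sum>v\<in>S. side_angle ?z (- ?n) v) = 2 * pi * of_int m'" "coloring S b R' = of_int m' + b"
    using germ_coloring[OF S R(2) cone(4,2) nv] only pos by fastforce
  have "{u \<in> S. ?z \<in> pedge D u} = (if v \<in> S then {v} else {})"
    using only on S by (auto simp: sublink_def)
  then have "2 * pi * of_int m - 2 * pi * of_int m' = (if v \<in> S then 2 * pi else 0)"
    using sum_side_angle_diff[OF finite_sublink[OF S], of ?z ?n "- ?n"] m(1) m'(1) pos
    by simp
  then have "2 * pi * of_int (m - m') = 2 * pi * of_int (if v \<in> S then 1 else 0)"
    by (simp add: algebra_simps)
  then have "m - m' = (if v \<in> S then 1 else 0)"
    by (simp only: mult_cancel_left of_int_eq_iff) simp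
  then have "m = m' + (if v \<in> S then 1 else 0)"
    by simp
  then have "coloring S b R + coloring S b R' = of_bool (v \<in> S)"
    unfolding m(2) m'(2) by (cases "of_int m' :: bit"; cases b) auto
  then show "across (coloring S b) v t (of_bool (v \<in> S))"
    using acrossI[OF R, of "coloring S b"] by simp
qed

text \<open>Going from the corner at - o + u to o + u, or from - o - u to o - u, crosses only the
  under-strand, which changes the winding number equally both times. Modulo 2 the resulting relation
  is symmetric in the four corners, so it is the coloring rule for either sign.\<close>

lemma coloring_in_Col:
  assumes S: "sublink D S"
  shows "coloring S b \<in> Col D"
proof -
  let ?C = "coloring S b"
  have "?C (right_region D c) = (case color_triple D ?C c of (x, y, z) \<Rightarrow> ternary x y z)"
    if c: "c \<in> crossings D" for c
  proof -
    obtain p q where pq: "c = (p, q)"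
      by (cases c)
    note c = c[unfolded pq]
    let ?o = "direction D p" and ?u = "direction D q" and ?z = "crossing_point D (p, q)"
    obtain s t where st: "p \<in> verts D" "q \<in> verts D" "p \<noteq> q" "s \<in> {0<..<1}" "t \<in> {0<..<1}"
      and z: "?z = edge_point D p s" "?z = edge_point D q t"
      and only: "\<And>v. v \<in> verts D \<Longrightarrow> ?z \<in> pedge D v \<Longrightarrow> v = p \<or> v = q"
      and nv: "?z \<notin> fst ` verts D"
      using crossing_cases[OF c] by metis
    have k: "wedge ?o ?u \<noteq> 0"
      using crossing_germs(2)[OF c] by blast
    have k': "wedge ?u ?o = - wedge ?o ?u"
      by (rule wedge_commute)
    have corner: "\<exists>m. (\<Sum>v\<in>S. side_angle ?z (a + d) v) = 2 * pi * of_int m \<and>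
        ?C (corner D (p, q) (a + d)) = of_int m + b"
      if ad: "a = ?o \<or> a = - ?o" "d = ?u \<or> d = - ?u" for a d
    proof -
      have nz: "wedge a d \<noteq> 0"
        using crossing_germs(2)[OF c ad] .
      obtain R where R: "germ D ?z (sector a d) R" "corner D (p, q) (a + d) = R"
        using crossing_germs(1)[OF c ad] by blast
      have "wedge (direction D v) (a + d) \<noteq> 0" if "v \<in> verts D" "?z \<in> pedge D v" for v
        using only[OF that] ad k k' by auto
      then show ?thesis
        using germ_coloring[OF S R(1) add_mem_sector[OF nz] blunt_cone_sector[OF nz] nv] R(2) by blast
    qed
    obtain m1 where m1: "(\<Sum>v\<in>S. side_angle ?z (?o + ?u) v) = 2 * pi * of_int m1"
      "?C (corner D (p, q) (?o + ?u)) = of_int m1 + b"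
      using corner by blast
    obtain m2 where m2: "(\<Sum>v\<in>S. side_angle ?z (- ?o + ?u) v) = 2 * pi * of_int m2"
      "?C (corner D (p, q) (?u - ?o)) = of_int m2 + b"
      using corner[of "- ?o" ?u] by auto
    obtain m3 where m3: "(\<Sum>v\<in>S. side_angle ?z (- ?o + - ?u) v) = 2 * pi * of_int m3"
      "?C (corner D (p, q) (- ?o - ?u)) = of_int m3 + b"
      using corner[of "- ?o" "- ?u"] by auto
    obtain m4 where m4: "(\<Sum>v\<in>S. side_angle ?z (?o + - ?u) v) = 2 * pi * of_int m4"
      "?C (corner D (p, q) (?o - ?u)) = of_int m4 + b"
      using corner[of "?o" "- ?u"] by auto
    have "2 * pi * of_int m1 - 2 * pi * of_int m2 = 2 * pi * of_int m4 - 2 * pi * of_int m3"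
      unfolding m1(1)[symmetric] m2(1)[symmetric] m3(1)[symmetric] m4(1)[symmetric]
        sum_side_angle_diff[OF finite_sublink[OF S]]
    proof (rule sum.cong[OF refl])
      fix v assume "v \<in> {v \<in> S. ?z \<in> pedge D v}"
      then have "v = p \<or> v = q"
        using only[of v] S unfolding sublink_def by blast
      then show "pi * (sgn (wedge (direction D v) (?o + ?u)) - sgn (wedge (direction D v) (- ?o + ?u))) =
          pi * (sgn (wedge (direction D v) (?o + - ?u)) - sgn (wedge (direction D v) (- ?o + - ?u)))"
        using k' by (auto simp: sgn_minus)
    qed
    then have "2 * pi * of_int (m1 - m2) = 2 * pi * of_int (m4 - m3)"
      by (simp add: algebra_simps)
    then have "m1 - m2 = m4 - m3"
      by (simp only: mult_cancel_left of_int_eq_iff) simp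
    then have "m4 = m1 - m2 + m3"
      by simp
    then have m4': "?C (corner D (p, q) (?o - ?u)) = of_int m1 - of_int m2 + of_int m3 + b"
      using m4(2) by simp
    let ?c1 = "?C (corner D (p, q) (?o + ?u))" and ?c2 = "?C (corner D (p, q) (?u - ?o))"
      and ?c3 = "?C (corner D (p, q) (- ?o - ?u))" and ?c4 = "?C (corner D (p, q) (?o - ?u))"
    have "?c4 = ?c1 + ?c2 + ?c3"
      unfolding m1(2) m2(2) m3(2) m4'
      by (cases "of_int m1 :: bit"; cases "of_int m2 :: bit"; cases "of_int m3 :: bit"; cases b) simp_all
    then have c2: "?c2 = ternary ?c4 ?c3 ?c1" and c4: "?c4 = ternary ?c2 ?c1 ?c3"
      by (cases ?c1; cases ?c2; cases ?c3; simp add: ternary_def)+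
    show ?thesis
    proof (cases "crossing_sign D (p, q) = 1")
      case True
      then have "color_triple D ?C (p, q) = (?c4, ?c3, ?c1)" "?C (right_region D (p, q)) = ?c2"
        by (simp_all only: color_triple_def left_region_def right_region_def top_region_def
            bottom_region_def over_dir_def under_dir_def fst_conv snd_conv simp_thms if_True)
      then show ?thesis
        unfolding pq using c2 by (simp only: prod.case)
    next
      case False
      then have "color_triple D ?C (p, q) = (?c2, ?c1, ?c3)" "?C (right_region D (p, q)) = ?c4"
        by (simp_all only: color_triple_def left_region_def right_region_def top_region_def
            bottom_region_def over_dir_def under_dir_def fst_conv snd_conv if_False)
      then show ?thesis
        unfolding pq using c4 by (simp only: prod.case)
    qed
  qed
  then show ?thesis
    by (auto simp: Col_def coloring_def)
qed

section \<open>Two colorings for every sublink\<close>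

lemma jump_set_coloring:
  assumes "sublink D S"
  shows "jump_set (coloring S b) = S"
proof -
  have "has_jump (coloring S b) v 1 \<longleftrightarrow> v \<in> S" if "v \<in> verts D" for v
    using has_jump_coloring[OF assms that, of b] has_jump_unique[OF that] by (cases "v \<in> S") fastforce+
  then show ?thesis
    using assms by (auto simp: jump_set_def sublink_def)
qed

text \<open>Guarantees that the shifts by 0 and 1 are different colorings, even for the empty link:
  a bounded curve does not fill the plane.\<close>

lemma regions_nonempty: "regions D \<noteq> {}"
proof -
  have "compact (plane_curve D)"
    unfolding plane_curve_eq pedge_def using finite_verts by (intro compact_UN) auto
  then have "plane_curve D \<noteq> UNIV"
    using compact_imp_bounded not_bounded_UNIV by metis
  then show ?thesis
    by (auto simp: regions_def)
qed

text \<open>A coloring and the winding coloring of its jump set have the same jumps, hence differ by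
  a constant.\<close>

lemma Col_eq:
  "Col D = (\<lambda>S. coloring S 0) ` {S. sublink D S} \<union> (\<lambda>S. coloring S 1) ` {S. sublink D S}"
proof -
  have "\<exists>b. C = coloring (jump_set C) b" if C: "C \<in> Col D" for C
  proof -
    let ?S = "jump_set C"
    have S: "sublink D ?S"
      by (rule sublink_jump_set[OF C])
    obtain b where b: "\<And>R. R \<in> regions D \<Longrightarrow> C R + coloring ?S 0 R = b"
      using same_jumps[OF C coloring_in_Col[OF S, of 0]] jump_set_coloring[OF S] by metis
    have "C R = coloring ?S b R" for R
    proof (cases "R \<in> regions D")
      case True
      then show ?thesis
        using b[OF True] by (cases "C R"; cases "of_int \<lfloor>wind D ?S (SOME z. z \<in> R)\<rfloor> :: bit")
          (auto simp: coloring_def)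
    next
      case False
      then show ?thesis
        using C by (auto simp: Col_def coloring_def PiE_def extensional_def)
    qed
    then show ?thesis
      by blast
  qed
  then show ?thesis
    using sublink_jump_set coloring_in_Col
    by (auto simp: image_iff) (metis bit_not_zero_iff)
qed

lemma coloring_neq: "coloring S 0 \<noteq> coloring S' 1" if "sublink D S" "sublink D S'"
proof
  assume eq: "coloring S 0 = coloring S' 1"
  then have "S = S'"
    using jump_set_coloring that by metis
  obtain R where "R \<in> regions D"
    using regions_nonempty by blast
  then show False
    using fun_cong[OF eq, of R] \<open>S = S'\<close>
    by (cases "of_int \<lfloor>wind D S (SOME z. z \<in> R)\<rfloor> :: bit") (simp_all add: coloring_def)
qed

text \<open>Since \<open>jump_set\<close> undoes \<open>coloring\<close>, the family for 0 and the
  family for 1 each list the sublinks without repetition, and they are disjoint.\<close>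

lemma image_mset_Col:
  "image_mset (\<lambda>C. f (jump_set C)) (mset_set (Col D)) =
    image_mset f (mset_set {S. sublink D S}) + image_mset f (mset_set {S. sublink D S})"
proof -
  let ?A = "{S. sublink D S}"
  have fin: "finite ?A"
    using finite_verts by (intro finite_subset[of "{S. sublink D S}" "Pow (verts D)"]) (auto simp: sublink_def)
  have one: "image_mset (\<lambda>C. f (jump_set C)) (mset_set ((\<lambda>S. coloring S b) ` ?A)) =
      image_mset f (mset_set ?A)" for b
  proof -
    have "inj_on (\<lambda>S. coloring S b) ?A"
      using jump_set_coloring by (metis inj_on_inverseI mem_Collect_eq)
    then have "mset_set ((\<lambda>S. coloring S b) ` ?A) = image_mset (\<lambda>S. coloring S b) (mset_set ?A)"
      by (rule image_mset_mset_set[symmetric])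
    then show ?thesis
      using fin jump_set_coloring by (auto simp: multiset.map_comp intro!: image_mset_cong)
  qed
  have "mset_set (Col D) = mset_set ((\<lambda>S. coloring S 0) ` ?A) + mset_set ((\<lambda>S. coloring S 1) ` ?A)"
    unfolding Col_eq using fin coloring_neq by (intro mset_set_Union) auto
  then show ?thesis
    using one by simp
qed

text \<open>The complement of a sublink is a sublink, so the first part of a decomposition is
  arbitrary and determines the second.\<close>

lemma LK_eq: "LK D = image_mset (\<lambda>S. lk D S (verts D - S)) (mset_set {S. sublink D S})"
proof -
  let ?A = "{S. sublink D S}" and ?h = "\<lambda>S. (S, verts D - S)"
  have "sublink D (verts D - S)" if "sublink D S" for S
  proof -
    have "nxt D ` (verts D - S) = nxt D ` verts D - nxt D ` S"
      by (rule image_set_diff) (simp add: inj_def nxt_eq_iff)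
    then show ?thesis
      using that permutes_image[OF permutes] by (auto simp: sublink_def)
  qed
  then have "decompositions D = ?h ` ?A"
    by (auto simp: decompositions_def sublink_def)
  moreover have "inj_on ?h ?A"
    by (auto simp: inj_on_def)
  ultimately have "mset_set (decompositions D) = image_mset ?h (mset_set ?A)"
    by (simp add: image_mset_mset_set)
  then show ?thesis
    by (simp add: LK_def multiset.map_comp comp_def)
qed

end

theorem corollary5p4:
  fixes L L' D D' :: link
  assumes "oriented_link L" and "oriented_link L'"
    and "diagram_of L D" and "diagram_of L' D'"
    and "\<exists>i\<in>{1, 2, 3, 4, 5}. Phi i D = Phi i D'"
  shows "LK D = LK D'"
proof -
  obtain i where i: "i \<in> {1, 2, 3, 4, 5}" "Phi i D = Phi i D'"
    using assms(5) by blast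
  \<comment> \<open>On the values that occur, the norm is an integer power of 2 and \<open>g\<close>
    returns its exponent; the floor only changes the type.\<close>
  define g :: "laurent \<Rightarrow> int" where "g p = \<lfloor>log 2 (norm (laurent_eval eval_point p))\<rfloor>" for p
  have double: "image_mset g (Phi i E) = LK E + LK E" if "diagram_of M E" for M E
  proof -
    interpret diagram E
      using that by unfold_locales (auto simp: diagram_of_def)
    have "g (beta i E C) = lk E (jump_set C) (verts E - jump_set C)" if C: "C \<in> Col E" for C
    proof -
      have "{c \<in> crossings E. color_triple E C c \<in> {(0, 0, 1), (1, 1, 0)}} =
          {c \<in> crossings E. fst c \<in> jump_set C \<and> snd c \<in> verts E - jump_set C}"
        using color_triple_jump_set[OF C] by blast
      then have "norm (laurent_eval eval_point (beta i E C)) =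
          2 powi lk E (jump_set C) (verts E - jump_set C)"
        unfolding lk_def using norm_eval_beta[OF finite_crossings i(1), of C] by metis
      then show ?thesis
        by (simp add: g_def powr_real_of_int'[symmetric])
    qed
    \<comment> \<open>\<open>mset_set\<close> of an infinite set is empty, so elements of
      \<open>Col E\<close> have to be considered only in the finite case.\<close>
    then have "image_mset g (Phi i E) =
        image_mset (\<lambda>C. lk E (jump_set C) (verts E - jump_set C)) (mset_set (Col E))"
      unfolding Phi_def multiset.map_comp comp_def
      by (cases "finite (Col E)") (auto intro!: image_mset_cong)
    then show ?thesis
      using image_mset_Col[of "\<lambda>S. lk E S (verts E - S)"] by (simp add: LK_eq)
  qed
  have "LK D + LK D = LK D' + LK D'"
    using double[OF assms(3)] double[OF assms(4)] i(2) by simp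
  \<comment> \<open>Multiplicities are natural numbers, so the doubling can be undone.\<close>
  then have "count (LK D) x = count (LK D') x" for x
    by (metis add_self_div_2 count_union)
  then show ?thesis
    by (simp add: multiset_eq_iff)
qed

end
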